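(* Let $\{S_i\}_{i=1}^m$ be an SS-IFS in $\mathbb{R}^d$ with attractor $K\subseteq\mathbb{R}^d$ containing at least two points, let $t=\dim_H(K)$, and let $L:\mathbb{R}^d\to\mathbb{R}^{d_2}$ be a linear map. If $\mathcal{H}^t(K)>0$, then $$\mathcal{H}^t\left(L\circ O(A)\right)=\frac{\mathcal{H}^t(A)}{\mathcal{H}^t(K)}\,\mathcal{H}^t\left(L(K)\right)$$ for all (not necessarily measurable) subsets $A\subseteq K$ and all $O\in\overline{\mathcal{T}}$.
   Context: $\dim_H$ denotes Hausdorff dimension and $\mathcal{H}^t$ denotes $t$-dimensional Hausdorff (outer) measure. $\mathbb{O}_d$ is the compact group of orthogonal transformations of $\mathbb{R}^d$, metrized by the Euclidean operator norm. A self-similar iterated function system (SS-IFS) in $\mathbb{R}^d$ is a finite collection $\{S_i\}_{i=1}^m$ of contracting similarities of $\mathbb{R}^d$, written uniquely as $S_i(x)=r_iT_i(x)+v_i$ with $0<r_i<1$, $T_i\in\mathbb{O}_d$ and $v_i\in\mathbb{R}^d$. Its attractor is the unique nonempty compact $K$ with $K=\bigcup_{i=1}^m S_i(K)$. Its transformation group $\mathcal{T}$ is the group generated by $T_1,\ldots,T_m$, and $\overline{\mathcal{T}}$ is the closure of $\mathcal{T}$ in $\mathbb{O}_d$. No separation condition is assumed. *)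

theory Defs
  imports "HOL-Analysis.Analysis" "HOL-Algebra.Generated_Groups"
begin

section \<open>Hausdorff measure and dimension\<close>

text \<open>
  The conventions for \<open>(diam U)^s\<close>: the empty set contributes \<open>0\<close> for every \<open>s\<close> (so that finite
  covers are covered by the countable case), and \<open>0^0 = 1\<close> for nonempty \<open>U\<close>, whereas
  \<open>0 powr 0 = 0\<close> in the library. Since \<^const>\<open>diameter\<close> is meaningful only for bounded sets,
  boundedness of the covering sets is required explicitly below.
\<close>

definition diam_power :: "real \<Rightarrow> 'a::metric_space set \<Rightarrow> ennreal" where
  "diam_power s U = (if U = {} then 0 else if s = 0 then 1 else ennreal (diameter U powr s))"

definition hausdorff_premeasure :: "real \<Rightarrow> real \<Rightarrow> 'a::metric_space set \<Rightarrow> ennreal" where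
  "hausdorff_premeasure s \<delta> A =
     (INF U \<in> {U :: nat \<Rightarrow> 'a set. A \<subseteq> (\<Union>n. U n) \<and> (\<forall>n. bounded (U n) \<and> diameter (U n) \<le> \<delta>)}.
        \<Sum>n. diam_power s (U n))"

text \<open>The supremum over \<open>\<delta> > 0\<close> is the limit as \<open>\<delta> \<rightarrow> 0\<close>, by monotonicity in \<open>\<delta>\<close>.\<close>

definition hausdorff_measure :: "real \<Rightarrow> 'a::metric_space set \<Rightarrow> ennreal" where
  "hausdorff_measure s A = (SUP \<delta> \<in> {0<..}. hausdorff_premeasure s \<delta> A)"

definition hausdorff_dim :: "'a::metric_space set \<Rightarrow> ereal" where
  "hausdorff_dim A = (INF s \<in> {s. 0 \<le> s \<and> hausdorff_measure s A = 0}. ereal s)"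


section \<open>The orthogonal group\<close>

text \<open>
  The norm on \<^typ>\<open>'a \<Rightarrow>\<^sub>L 'a\<close> is the operator norm.
\<close>

definition orthogonal_group :: "('a::euclidean_space \<Rightarrow>\<^sub>L 'a) monoid" where
  "orthogonal_group =
     \<lparr>carrier = {T. orthogonal_transformation (blinfun_apply T)}, mult = (o\<^sub>L), one = id_blinfun\<rparr>"

lemma group_orthogonal_group: "group (orthogonal_group :: ('a::euclidean_space \<Rightarrow>\<^sub>L 'a) monoid)"
proof (rule groupI)
  fix T :: "'a \<Rightarrow>\<^sub>L 'a" assume "T \<in> carrier orthogonal_group"
  then have T: "orthogonal_transformation (blinfun_apply T)"
    by (simp add: orthogonal_group_def)
  define T' where "T' = Blinfun (inv_into UNIV (blinfun_apply T))"
  have orth: "orthogonal_transformation (inv_into UNIV (blinfun_apply T))"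
    using T by (rule orthogonal_transformation_inv)
  then have "bounded_linear (inv_into UNIV (blinfun_apply T))"
    by (simp add: orthogonal_transformation_linear linear_conv_bounded_linear[symmetric])
  then have apply_T': "blinfun_apply T' = inv_into UNIV (blinfun_apply T)"
    by (simp add: T'_def bounded_linear_Blinfun_apply)
  have "T' o\<^sub>L T = id_blinfun"
    using orthogonal_transformation_inj[OF T] by (intro blinfun_eqI) (simp add: apply_T')
  with apply_T' orth show "\<exists>U \<in> carrier orthogonal_group. U \<otimes>\<^bsub>orthogonal_group\<^esub> T = \<one>\<^bsub>orthogonal_group\<^esub>"
    by (intro bexI[of _ T']) (simp_all add: orthogonal_group_def)
qed (auto simp: orthogonal_group_def orthogonal_transformation_def
       blinfun.bilinear_simps linear_iff intro!: blinfun_eqI)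


section \<open>Self-similar iterated function systems\<close>

definition ss_ifs ::
  "nat \<Rightarrow> (nat \<Rightarrow> 'a \<Rightarrow> 'a) \<Rightarrow> (nat \<Rightarrow> real) \<Rightarrow> (nat \<Rightarrow> 'a \<Rightarrow>\<^sub>L 'a) \<Rightarrow> (nat \<Rightarrow> 'a::euclidean_space) \<Rightarrow> bool"
where
  "ss_ifs m S r T v \<longleftrightarrow>
     (\<forall>i \<in> {1..m}. 0 < r i \<and> r i < 1 \<and> T i \<in> carrier orthogonal_group \<and>
        (\<forall>x. S i x = r i *\<^sub>R blinfun_apply (T i) x + v i))"

definition is_attractor :: "nat \<Rightarrow> (nat \<Rightarrow> 'a \<Rightarrow> 'a) \<Rightarrow> 'a::topological_space set \<Rightarrow> bool" where
  "is_attractor m S K \<longleftrightarrow> K \<noteq> {} \<and> compact K \<and> K = (\<Union>i \<in> {1..m}. S i ` K)"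

definition transformation_group ::
  "nat \<Rightarrow> (nat \<Rightarrow> 'a::euclidean_space \<Rightarrow>\<^sub>L 'a) \<Rightarrow> ('a \<Rightarrow>\<^sub>L 'a) set" where
  "transformation_group m T = generate orthogonal_group (T ` {1..m})"

definition closed_transformation_group ::
  "nat \<Rightarrow> (nat \<Rightarrow> 'a::euclidean_space \<Rightarrow>\<^sub>L 'a) \<Rightarrow> ('a \<Rightarrow>\<^sub>L 'a) set" where
  "closed_transformation_group m T =
     carrier orthogonal_group \<inter> closure (transformation_group m T)"

end

(*
  Write M for the measure of K, diam K for its diameter and G for the closure of the set of rotations of
  words, which is a compact group. If finitely many pairwise disjoint cylinders had sum of
  ratios^t above 1, they would force dim K > t, so Vitali's covering lemma bounds the measure of
  the part of K in an open set by (10 diam K)^t times the sum of ratios^t of suitable disjoint cylinders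
  inside that set. Hence M is finite, and K \<inter> U can be exhausted up to small measure by disjoint
  small cylinders whose rotations are close to any prescribed Q in G. Covering each piece of the
  exhaustion by a copy of one fixed cover of L(Q(K)) gives
    M * H(L(K \<inter> U)) \<le> H_D(L(Q(K))) * H(K \<inter> U)
  for the premeasure H_D at every scale D > 0. With U the whole space, H(L(K)) \<le> H_D(L(Q(K))): the
  measure of L(Q(K)) does not depend on Q and equals the premeasure at every scale. In particular
  open sets satisfy H(K \<inter> U) \<le> (diam U)^t, and comparing arbitrary open covers of A and of L(A)
  yields both inequalities.
*)
theory Submission
  imports Defs
begin

section \<open>Hausdorff premeasures\<close>

text \<open>The rotations must be steered because \<open>L\<close> commutes with scaling but not
  with \<open>Tw w\<close>: the image of a cylinder is a small translated copy of \<open>L\<close>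
  applied to a rotated \<open>K\<close>. A cover of a fixed scale \<open>D\<close> becomes
  arbitrarily fine under this shrinking, which is why a premeasure at a coarse scale can control the
  full measure.

  The obstacle on the image side is that covers bound measures only from above, while the images of
  disjoint cylinders may coincide. The lower bound comes from complements: at a scale that admits
  \<open>V\<close> itself as a single covering set, \<open>V\<close> together with the image of the
  part of \<open>K\<close> outside the preimage of \<open>V\<close> covers the image of
  \<open>K\<close>, and the upper bound already known for that part is subtracted.

  Arbitrary \<open>A\<close> are reached because measurability never enters: sets at positive
  distance are additive, hence so are disjoint compact sets, and this is enough to split
  \<open>K\<close> along open sets. The comparison inequalities stay multiplied out by the measure
  of \<open>K\<close>; the image of \<open>K\<close> may have measure 0, so no step divides by its
  measure.\<close>

lemma diam_power_empty [simp]: "diam_power s {} = 0"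
  by (simp add: diam_power_def)

lemma diam_power_mono:
  assumes "A \<subseteq> B" "bounded B" "0 \<le> s"
  shows "diam_power s A \<le> diam_power s B"
  using assms
  by (auto simp: diam_power_def intro!: ennreal_leI powr_mono2 diameter_subset diameter_ge_0
      intro: bounded_subset)

lemma diam_power_pos_exponent:
  assumes "0 < s"
  shows "diam_power s A = ennreal (diameter A powr s)"
  using assms by (auto simp: diam_power_def)

lemma hausdorff_premeasure_le:
  assumes "A \<subseteq> (\<Union>n. U n)" "\<And>n. bounded (U n)" "\<And>n. diameter (U n) \<le> \<delta>"
  shows "hausdorff_premeasure s \<delta> A \<le> (\<Sum>n. diam_power s (U n))"
  unfolding hausdorff_premeasure_def by (rule INF_lower) (use assms in auto)

lemma hausdorff_premeasure_lessD:
  assumes "hausdorff_premeasure s \<delta> A < a"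
  shows "\<exists>U. A \<subseteq> (\<Union>n. U n) \<and> (\<forall>n. bounded (U n) \<and> diameter (U n) \<le> \<delta>) \<and>
    (\<Sum>n. diam_power s (U n)) < a"
  using assms unfolding hausdorff_premeasure_def by (auto simp: INF_less_iff)

lemma le_hausdorff_premeasure:
  assumes "\<And>U. A \<subseteq> (\<Union>n. U n) \<Longrightarrow> (\<And>n. bounded (U n)) \<Longrightarrow> (\<And>n. diameter (U n) \<le> \<delta>) \<Longrightarrow>
    a \<le> (\<Sum>n. diam_power s (U n))"
  shows "a \<le> hausdorff_premeasure s \<delta> A"
  unfolding hausdorff_premeasure_def by (rule INF_greatest) (use assms in auto)

lemma hausdorff_premeasure_mono:
  "A \<subseteq> B \<Longrightarrow> hausdorff_premeasure s \<delta> A \<le> hausdorff_premeasure s \<delta> B"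
  by (rule le_hausdorff_premeasure) (auto intro!: hausdorff_premeasure_le)

lemma hausdorff_premeasure_antimono:
  assumes "\<delta> \<le> \<epsilon>"
  shows "hausdorff_premeasure s \<epsilon> A \<le> hausdorff_premeasure s \<delta> A"
proof (rule le_hausdorff_premeasure)
  fix U :: "nat \<Rightarrow> _" assume U: "A \<subseteq> (\<Union>n. U n)" "\<And>n. bounded (U n)" "\<And>n. diameter (U n) \<le> \<delta>"
  show "hausdorff_premeasure s \<epsilon> A \<le> (\<Sum>n. diam_power s (U n))"
    by (rule hausdorff_premeasure_le) (use U assms order_trans in blast)+
qed

lemma hausdorff_premeasure_le_diam_power:
  assumes "bounded A" "diameter A \<le> \<delta>" "0 \<le> \<delta>"
  shows "hausdorff_premeasure s \<delta> A \<le> diam_power s A"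
proof -
  have "hausdorff_premeasure s \<delta> A \<le> (\<Sum>n. diam_power s (if n = 0 then A else {}))"
    by (rule hausdorff_premeasure_le) (use assms in auto)
  also have "\<dots> = (\<Sum>n\<in>{0::nat}. diam_power s (if n = 0 then A else {}))"
    by (rule suminf_finite) auto
  finally show ?thesis by simp
qed

lemma hausdorff_premeasure_empty [simp]:
  "0 \<le> \<delta> \<Longrightarrow> hausdorff_premeasure s \<delta> {} = 0"
  using hausdorff_premeasure_le_diam_power[of "{}" \<delta> s] by (simp add: diameter_empty)

lemma hausdorff_premeasure_countable_subadditive:
  "hausdorff_premeasure s \<delta> (\<Union>i. A i) \<le> (\<Sum>i. hausdorff_premeasure s \<delta> (A i))"
proof (cases "(\<Sum>i. hausdorff_premeasure s \<delta> (A i)) = \<infinity>")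
  case False
  then have fin: "hausdorff_premeasure s \<delta> (A i) < \<infinity>" for i
    using ennreal_suminf_lessD[of "\<lambda>i. hausdorff_premeasure s \<delta> (A i)" \<infinity> i] by (simp add: less_top)
  show ?thesis
  proof (rule ennreal_le_epsilon)
    fix e :: real assume e: "0 < e"
    have "\<exists>U. A i \<subseteq> (\<Union>n. U n) \<and> (\<forall>n. bounded (U n) \<and> diameter (U n) \<le> \<delta>) \<and>
      (\<Sum>n. diam_power s (U n)) < hausdorff_premeasure s \<delta> (A i) + ennreal (e * (1/2) ^ Suc i)" for i
    proof (rule hausdorff_premeasure_lessD)
      show "hausdorff_premeasure s \<delta> (A i) < hausdorff_premeasure s \<delta> (A i) + ennreal (e * (1/2) ^ Suc i)"
        using fin[of i] e
          ennreal_add_left_cancel_less[of "hausdorff_premeasure s \<delta> (A i)" 0 "ennreal (e * (1/2) ^ Suc i)"]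
        by (simp add: less_top)
    qed
    then obtain U where U: "\<And>i. A i \<subseteq> (\<Union>n. U i n)" "\<And>i n. bounded (U i n)"
        "\<And>i n. diameter (U i n) \<le> \<delta>"
        "\<And>i. (\<Sum>n. diam_power s (U i n)) < hausdorff_premeasure s \<delta> (A i) + ennreal (e * (1/2) ^ Suc i)"
      by metis
    define V where "V k = (case prod_decode k of (i, n) \<Rightarrow> U i n)" for k
    have "hausdorff_premeasure s \<delta> (\<Union>i. A i) \<le> (\<Sum>k. diam_power s (V k))"
    proof (rule hausdorff_premeasure_le)
      have "V (prod_encode (i, n)) = U i n" for i n by (simp add: V_def)
      then have "U i n \<subseteq> (\<Union>k. V k)" for i n by (metis UN_upper UNIV_I)
      then show "(\<Union>i. A i) \<subseteq> (\<Union>k. V k)" using U(1) by (meson UN_least order_trans)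
    qed (use U in \<open>auto simp: V_def split: prod.splits\<close>)
    also have "\<dots> = (\<Sum>k. case prod_decode k of (i, n) \<Rightarrow> diam_power s (U i n))"
      by (simp add: V_def split_beta)
    also have "\<dots> = (\<Sum>i. \<Sum>n. diam_power s (U i n))"
      using suminf_ennreal_2dimen[of "\<lambda>i. \<Sum>n. diam_power s (U i n)" "\<lambda>(i, n). diam_power s (U i n)"]
      by (simp add: comp_def)
    also have "\<dots> \<le> (\<Sum>i. hausdorff_premeasure s \<delta> (A i) + ennreal (e * (1/2) ^ Suc i))"
      using U(4) by (intro suminf_le) (auto intro: less_imp_le)
    also have "\<dots> = (\<Sum>i. hausdorff_premeasure s \<delta> (A i)) + (\<Sum>i. ennreal (e * (1/2) ^ Suc i))"
      by (simp add: suminf_add)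
    also have "(\<Sum>i. ennreal (e * (1/2) ^ Suc i)) = ennreal e"
      using e sums_mult[OF power_half_series, of e] by (intro suminf_ennreal_eq) auto
    finally show "hausdorff_premeasure s \<delta> (\<Union>i. A i)
      \<le> (\<Sum>i. hausdorff_premeasure s \<delta> (A i)) + ennreal e" .
  qed
qed simp

lemma hausdorff_premeasure_finite_subadditive:
  assumes "finite I" "0 \<le> \<delta>"
  shows "hausdorff_premeasure s \<delta> (\<Union>i\<in>I. A i) \<le> (\<Sum>i\<in>I. hausdorff_premeasure s \<delta> (A i))"
  using assms
proof (induction I rule: finite_induct)
  case (insert i I)
  define B where "B n = (if n = 0 then A i else if n = Suc 0 then \<Union>j\<in>I. A j else {})" for n :: nat
  have "(\<Union>j\<in>insert i I. A j) = (\<Union>n. B n)"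
    by (auto simp: B_def split: if_splits)
  then have "hausdorff_premeasure s \<delta> (\<Union>j\<in>insert i I. A j) \<le> (\<Sum>n. hausdorff_premeasure s \<delta> (B n))"
    using hausdorff_premeasure_countable_subadditive[of s \<delta> B] by simp
  also have "\<dots> = (\<Sum>n\<in>{0, Suc 0}. hausdorff_premeasure s \<delta> (B n))"
    using insert.prems by (intro suminf_finite) (auto simp: B_def)
  also have "\<dots> = hausdorff_premeasure s \<delta> (A i) + hausdorff_premeasure s \<delta> (\<Union>j\<in>I. A j)"
    by (simp add: B_def)
  also have "\<dots> \<le> hausdorff_premeasure s \<delta> (A i) + (\<Sum>j\<in>I. hausdorff_premeasure s \<delta> (A j))"
    using insert by (intro add_left_mono) auto
  finally show ?case using insert.hyps by simp
qed simp

lemma hausdorff_premeasure_Un: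
  assumes "0 \<le> \<delta>"
  shows "hausdorff_premeasure s \<delta> (A \<union> B) \<le> hausdorff_premeasure s \<delta> A + hausdorff_premeasure s \<delta> B"
  using hausdorff_premeasure_finite_subadditive[of "{True, False}" \<delta> s "\<lambda>b. if b then A else B"] assms
  by (simp add: Un_commute add.commute)

lemma diameter_leI:
  fixes A :: "'a::metric_space set"
  assumes "\<And>x y. x \<in> A \<Longrightarrow> y \<in> A \<Longrightarrow> dist x y \<le> d" "0 \<le> d"
  shows "diameter A \<le> d"
  unfolding diameter_def using assms by (auto intro!: cSUP_least)

lemma diameter_image_le:
  assumes "\<And>x y. x \<in> A \<Longrightarrow> y \<in> A \<Longrightarrow> dist (g x) (g y) \<le> c * dist x y" "bounded A" "0 \<le> c"
  shows "bounded (g ` A)" "diameter (g ` A) \<le> c * diameter A"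
proof -
  have *: "dist (g x) (g y) \<le> c * diameter A" if "x \<in> A" "y \<in> A" for x y
    using assms(1)[OF that] mult_left_mono[OF diameter_bounded_bound[OF assms(2) that] assms(3)]
    by linarith
  show "bounded (g ` A)" unfolding bounded_two_points using * by blast
  show "diameter (g ` A) \<le> c * diameter A"
    by (rule diameter_leI) (use * assms diameter_ge_0[OF assms(2)] in auto)
qed

lemma hausdorff_premeasure_lipschitz:
  assumes lip: "\<And>x y. x \<in> A \<Longrightarrow> y \<in> A \<Longrightarrow> dist (g x) (g y) \<le> c * dist x y" and "0 < c" "0 \<le> s"
  shows "hausdorff_premeasure s (c * \<delta>) (g ` A) \<le> ennreal (c powr s) * hausdorff_premeasure s \<delta> A"
proof -
  \<comment> \<open>An infimum is bounded below cover by cover, so the constant is first divided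
    over to the left.\<close>
  have "hausdorff_premeasure s (c * \<delta>) (g ` A) / ennreal (c powr s) \<le> hausdorff_premeasure s \<delta> A"
  proof (rule le_hausdorff_premeasure)
    fix U :: "nat \<Rightarrow> _" assume U: "A \<subseteq> (\<Union>n. U n)" "\<And>n. bounded (U n)" "\<And>n. diameter (U n) \<le> \<delta>"
    \<comment> \<open>The map is Lipschitz on \<open>A\<close> only, so the covering sets are cut
      down to \<open>A\<close> before taking images.\<close>
    have bd: "bounded (A \<inter> U n)" for n using U(2) by auto
    note d = diameter_image_le[of "A \<inter> U _" g c, OF _ bd]
    have d1: "bounded (g ` (A \<inter> U n))" "diameter (g ` (A \<inter> U n)) \<le> c * diameter (A \<inter> U n)" for n
      using d[of n] lip \<open>0 < c\<close> by auto
    have d2: "diameter (A \<inter> U n) \<le> diameter (U n)" for n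
      using U(2) by (intro diameter_subset) auto
    have d3: "diameter (g ` (A \<inter> U n)) \<le> c * diameter (U n)" for n
      using d1(2)[of n] mult_left_mono[OF d2[of n], of c] \<open>0 < c\<close> by linarith
    have "hausdorff_premeasure s (c * \<delta>) (g ` A) \<le> (\<Sum>n. diam_power s (g ` (A \<inter> U n)))"
    proof (rule hausdorff_premeasure_le)
      show "diameter (g ` (A \<inter> U n)) \<le> c * \<delta>" for n
        using d3[of n] mult_left_mono[OF U(3)[of n], of c] \<open>0 < c\<close> by linarith
      show "g ` A \<subseteq> (\<Union>n. g ` (A \<inter> U n))" using U(1) by blast
    qed (use d1 in auto)
    also have "\<dots> \<le> (\<Sum>n. ennreal (c powr s) * diam_power s (U n))"
    proof (intro suminf_le)
      fix n
      have "0 \<le> diameter (U n)" using U(2) by (rule diameter_ge_0)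
      moreover have "0 \<le> diameter (g ` (A \<inter> U n))" using d1(1) by (rule diameter_ge_0)
      ultimately have "diameter (g ` (A \<inter> U n)) powr s \<le> c powr s * diameter (U n) powr s"
        using d3[of n] \<open>0 < c\<close> \<open>0 \<le> s\<close> by (metis powr_mono2 powr_mult less_imp_le)
      then show "diam_power s (g ` (A \<inter> U n)) \<le> ennreal (c powr s) * diam_power s (U n)"
        using \<open>0 < c\<close> by (auto simp: diam_power_def ennreal_mult[symmetric] intro!: ennreal_leI)
    qed auto
    also have "\<dots> = ennreal (c powr s) * (\<Sum>n. diam_power s (U n))" by simp
    finally show "hausdorff_premeasure s (c * \<delta>) (g ` A) / ennreal (c powr s)
        \<le> (\<Sum>n. diam_power s (U n))"
      using \<open>0 < c\<close> by (intro divide_le_posI_ennreal) (auto simp: mult.commute)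
  qed
  then have "ennreal (c powr s) * (hausdorff_premeasure s (c * \<delta>) (g ` A) / ennreal (c powr s))
      \<le> ennreal (c powr s) * hausdorff_premeasure s \<delta> A"
    by (rule mult_left_mono) simp
  moreover have "ennreal (c powr s) * (hausdorff_premeasure s (c * \<delta>) (g ` A) / ennreal (c powr s))
      = hausdorff_premeasure s (c * \<delta>) (g ` A)"
    using \<open>0 < c\<close> by (simp add: ennreal_times_divide mult.commute[of "ennreal (c powr s)"]
        mult_divide_eq_ennreal)
  ultimately show ?thesis by simp
qed

section \<open>Replacing covers by open covers\<close>

lemma fatten_bounds:
  fixes U :: "'a::metric_space set"
  assumes "bounded U" "0 < e"
  shows "bounded (\<Union>x\<in>U. ball x e)" "diameter (\<Union>x\<in>U. ball x e) \<le> diameter U + 2 * e"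
proof -
  have *: "dist x y \<le> diameter U + 2 * e" if xy: "x \<in> (\<Union>x\<in>U. ball x e)" "y \<in> (\<Union>x\<in>U. ball x e)" for x y
  proof -
    obtain u w where u: "u \<in> U" "dist u x < e" and w: "w \<in> U" "dist w y < e" using xy by auto
    have "dist u w \<le> diameter U" by (rule diameter_bounded_bound) (use assms u w in auto)
    moreover have "dist x y \<le> dist u x + dist u w + dist w y" by metric
    ultimately show ?thesis using u w by linarith
  qed
  show "bounded (\<Union>x\<in>U. ball x e)" unfolding bounded_two_points using * by blast
  show "diameter (\<Union>x\<in>U. ball x e) \<le> diameter U + 2 * e"
    by (rule diameter_leI) (use * assms diameter_ge_0[OF assms(1)] in auto)
qed

text \<open>Compactness arguments and splittings along preimages need open covering sets. Each set
  is fattened by a radius so small that its contribution grows by at most a geometric share of the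
  slack below \<open>a\<close>; the fattening is what raises the scale from \<delta> to
  \<epsilon>.\<close>

lemma hausdorff_premeasure_lessD_open:
  fixes A :: "'a::metric_space set"
  assumes "hausdorff_premeasure s \<delta> A < a" "\<delta> < \<epsilon>" "0 \<le> s"
  shows "\<exists>U. A \<subseteq> (\<Union>n. U n) \<and> (\<forall>n. open (U n) \<and> bounded (U n) \<and> diameter (U n) \<le> \<epsilon>) \<and>
    (\<Sum>n. diam_power s (U n)) < a"
proof -
  obtain U :: "nat \<Rightarrow> 'a set" where U: "A \<subseteq> (\<Union>n. U n)" "\<And>n. bounded (U n)" "\<And>n. diameter (U n) \<le> \<delta>"
      "(\<Sum>n. diam_power s (U n)) < a"
    using hausdorff_premeasure_lessD[OF assms(1)] by metis
  \<comment> \<open>The intermediate \<open>b\<close> is finite even if \<open>a\<close> is not, so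
    the slack \<eta> is a genuine real number, and a total of at most \<open>b\<close> is still
    strictly below \<open>a\<close>.\<close>
  obtain b where b: "(\<Sum>n. diam_power s (U n)) < b" "b < a" using dense[OF U(4)] by blast
  define \<eta> where "\<eta> = enn2real b - enn2real (\<Sum>n. diam_power s (U n))"
  have fin: "(\<Sum>n. diam_power s (U n)) < \<infinity>" "b < \<infinity>"
    using b by (auto simp: less_top intro: less_le_trans)
  have "enn2real (\<Sum>n. diam_power s (U n)) < enn2real b"
    using b fin by (simp add: enn2real_less_iff)
  then have \<eta>: "0 < \<eta>" by (simp add: \<eta>_def)
  have sum_\<eta>: "(\<Sum>n. diam_power s (U n)) + ennreal \<eta> = b"
  proof -
    have "(\<Sum>n. diam_power s (U n)) + ennreal \<eta>
        = ennreal (enn2real (\<Sum>n. diam_power s (U n))) + ennreal \<eta>"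
      using fin by simp
    also have "\<dots> = ennreal (enn2real b)"
      using \<eta> by (subst ennreal_plus[symmetric]) (auto simp: \<eta>_def)
    finally show ?thesis using fin by simp
  qed
  have "\<exists>e>0. 2 * e \<le> \<epsilon> - \<delta> \<and>
      diam_power s (\<Union>x\<in>U n. ball x e) \<le> diam_power s (U n) + ennreal (\<eta> * (1/2) ^ Suc n)" for n
  proof (cases "s = 0 \<or> U n = {}")
    case True
    then show ?thesis using assms(2)
      by (intro exI[of _ "(\<epsilon> - \<delta>) / 2"]) (auto simp: diam_power_def)
  next
    case False
    then have s: "0 < s" using assms(3) by simp
    let ?d = "diameter (U n)" and ?h = "\<eta> * (1/2) ^ Suc n"
    have d: "0 \<le> ?d" using U(2) by (rule diameter_ge_0)
    \<comment> \<open>The diameter may be 0; continuity of the power at base 0 is where the positive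
      exponent is needed.\<close>
    have "((\<lambda>e. (?d + 2 * e) powr s) \<longlongrightarrow> (?d + 2 * 0) powr s) (at_right 0)"
      using s d by (intro tendsto_intros tendsto_powr'[where b = s]) (auto simp: eventually_at_right_less
          intro!: eventually_at_rightI[of 0 1])
    moreover have "(?d + 2 * 0) powr s < ?d powr s + ?h" using \<eta> by simp
    ultimately have "\<forall>\<^sub>F e in at_right 0. (?d + 2 * e) powr s < ?d powr s + ?h"
      by (rule order_tendstoD(2))
    moreover have "\<forall>\<^sub>F e in at_right (0::real). e < (\<epsilon> - \<delta>) / 2"
      using assms(2) by (intro eventually_at_rightI[of 0 "(\<epsilon> - \<delta>) / 2"]) auto
    moreover have "\<forall>\<^sub>F e in at_right (0::real). 0 < e" by (simp add: eventually_at_right_less)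
    ultimately have "\<forall>\<^sub>F e in at_right 0. (?d + 2 * e) powr s < ?d powr s + ?h \<and> e < (\<epsilon> - \<delta>) / 2 \<and> 0 < e"
      by eventually_elim auto
    then obtain e where e: "(?d + 2 * e) powr s < ?d powr s + ?h" "e < (\<epsilon> - \<delta>) / 2" "0 < e"
      using eventually_happens[of _ "at_right (0::real)"] trivial_limit_at_right_real by blast
    have "diameter (\<Union>x\<in>U n. ball x e) powr s \<le> (?d + 2 * e) powr s"
      using fatten_bounds[OF U(2)[of n] e(3)] s by (intro powr_mono2 diameter_ge_0) auto
    then have "diam_power s (\<Union>x\<in>U n. ball x e) \<le> ennreal (?d powr s + ?h)"
      using e(1) s by (auto simp: diam_power_pos_exponent intro!: ennreal_leI)
    also have "\<dots> = diam_power s (U n) + ennreal ?h"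
      using \<eta> s by (simp add: diam_power_pos_exponent)
    finally show ?thesis using e by (intro exI[of _ e]) auto
  qed
  then obtain e where e: "\<And>n. 0 < e n" "\<And>n. 2 * e n \<le> \<epsilon> - \<delta>"
    "\<And>n. diam_power s (\<Union>x\<in>U n. ball x (e n)) \<le> diam_power s (U n) + ennreal (\<eta> * (1/2) ^ Suc n)"
    by metis
  define V where "V n = (\<Union>x\<in>U n. ball x (e n))" for n
  have UV: "U n \<subseteq> V n" for n using e(1)[of n] by (auto simp: V_def)
  have V: "open (V n)" "bounded (V n)" "diameter (V n) \<le> \<epsilon>" for n
    using fatten_bounds[OF U(2)[of n] e(1)[of n]] e(2)[of n] U(3)[of n] by (auto simp: V_def)
  have "(\<Sum>n. diam_power s (V n)) \<le> (\<Sum>n. diam_power s (U n) + ennreal (\<eta> * (1/2) ^ Suc n))"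
    using e(3) by (intro suminf_le) (auto simp: V_def)
  also have "\<dots> = (\<Sum>n. diam_power s (U n)) + (\<Sum>n. ennreal (\<eta> * (1/2) ^ Suc n))"
    by (simp add: suminf_add)
  also have "(\<Sum>i. ennreal (\<eta> * (1/2) ^ Suc i)) = ennreal \<eta>"
    using \<eta> sums_mult[OF power_half_series, of \<eta>] by (intro suminf_ennreal_eq) auto
  finally have "(\<Sum>n. diam_power s (V n)) < a" using sum_\<eta> b by simp
  moreover have "A \<subseteq> (\<Union>n. V n)"
    using U(1) UV by (meson UN_mono order_trans order_refl)
  ultimately show ?thesis using V by blast
qed

section \<open>Hausdorff measures\<close>

lemma hausdorff_premeasure_le_measure:
  "0 < \<delta> \<Longrightarrow> hausdorff_premeasure s \<delta> A \<le> hausdorff_measure s A"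
  unfolding hausdorff_measure_def by (rule SUP_upper) auto

lemma hausdorff_measure_leI:
  "(\<And>\<delta>. 0 < \<delta> \<Longrightarrow> hausdorff_premeasure s \<delta> A \<le> a) \<Longrightarrow> hausdorff_measure s A \<le> a"
  unfolding hausdorff_measure_def by (rule SUP_least) auto

lemma hausdorff_measure_mono:
  "A \<subseteq> B \<Longrightarrow> hausdorff_measure s A \<le> hausdorff_measure s B"
  by (rule hausdorff_measure_leI)
    (meson hausdorff_premeasure_mono hausdorff_premeasure_le_measure order_trans)

lemma hausdorff_measure_countable_subadditive:
  "hausdorff_measure s (\<Union>i. A i) \<le> (\<Sum>i. hausdorff_measure s (A i))"
proof (rule hausdorff_measure_leI)
  fix \<delta> :: real assume "0 < \<delta>"
  then have "(\<Sum>i. hausdorff_premeasure s \<delta> (A i)) \<le> (\<Sum>i. hausdorff_measure s (A i))"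
    by (intro suminf_le) (auto intro: hausdorff_premeasure_le_measure)
  then show "hausdorff_premeasure s \<delta> (\<Union>i. A i) \<le> (\<Sum>i. hausdorff_measure s (A i))"
    using hausdorff_premeasure_countable_subadditive order_trans by blast
qed

lemma hausdorff_measure_Un:
  "hausdorff_measure s (A \<union> B) \<le> hausdorff_measure s A + hausdorff_measure s B"
proof (rule hausdorff_measure_leI)
  fix \<delta> :: real assume "0 < \<delta>"
  then show "hausdorff_premeasure s \<delta> (A \<union> B) \<le> hausdorff_measure s A + hausdorff_measure s B"
    by (intro order_trans[OF hausdorff_premeasure_Un] add_mono hausdorff_premeasure_le_measure) auto
qed

lemma hausdorff_measure_lipschitz:
  assumes "\<And>x y. x \<in> A \<Longrightarrow> y \<in> A \<Longrightarrow> dist (g x) (g y) \<le> c * dist x y" "0 < c" "0 \<le> s"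
  shows "hausdorff_measure s (g ` A) \<le> ennreal (c powr s) * hausdorff_measure s A"
proof (rule hausdorff_measure_leI)
  fix \<delta> :: real assume "0 < \<delta>"
  have "hausdorff_premeasure s (c * (\<delta> / c)) (g ` A) \<le> ennreal (c powr s) * hausdorff_premeasure s (\<delta> / c) A"
    by (rule hausdorff_premeasure_lipschitz) (use assms in auto)
  also have "\<dots> \<le> ennreal (c powr s) * hausdorff_measure s A"
    using \<open>0 < c\<close> \<open>0 < \<delta>\<close> by (intro mult_left_mono hausdorff_premeasure_le_measure) auto
  finally show "hausdorff_premeasure s \<delta> (g ` A) \<le> ennreal (c powr s) * hausdorff_measure s A"
    using \<open>0 < c\<close> by simp
qed

lemma hausdorff_measure_similarity:
  assumes sim: "\<And>x y. x \<in> A \<Longrightarrow> y \<in> A \<Longrightarrow> dist (g x) (g y) = c * dist x y" and "0 < c" "0 \<le> s"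
  shows "hausdorff_measure s (g ` A) = ennreal (c powr s) * hausdorff_measure s A"
proof (rule antisym)
  show "hausdorff_measure s (g ` A) \<le> ennreal (c powr s) * hausdorff_measure s A"
    by (rule hausdorff_measure_lipschitz) (use assms in auto)
  have inj: "inj_on g A"
    by (rule inj_onI) (metis sim \<open>0 < c\<close> dist_self dist_eq_0_iff mult_eq_0_iff less_irrefl)
  have "hausdorff_measure s (inv_into A g ` g ` A) \<le> ennreal ((1 / c) powr s) * hausdorff_measure s (g ` A)"
    by (rule hausdorff_measure_lipschitz) (use assms inj in auto)
  then have "hausdorff_measure s A \<le> ennreal ((1 / c) powr s) * hausdorff_measure s (g ` A)"
    using inj by simp
  then have "ennreal (c powr s) * hausdorff_measure s A
      \<le> ennreal (c powr s) * (ennreal ((1 / c) powr s) * hausdorff_measure s (g ` A))"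
    by (rule mult_left_mono) simp
  also have "\<dots> = ennreal (c powr s * (1 / c) powr s) * hausdorff_measure s (g ` A)"
    by (simp add: ennreal_mult mult.assoc)
  also have "c powr s * (1 / c) powr s = 1"
    using \<open>0 < c\<close> by (simp add: powr_divide)
  finally show "ennreal (c powr s) * hausdorff_measure s A \<le> hausdorff_measure s (g ` A)" by simp
qed

section \<open>Additivity on sets at positive distance\<close>

text \<open>A covering set of diameter at most \<delta> < \<open>e\<close> cannot meet both sets, so
  a cover of the union splits into covers of the two parts without using any set twice.\<close>

lemma hausdorff_premeasure_separated:
  assumes sep: "\<And>x y. x \<in> A \<Longrightarrow> y \<in> B \<Longrightarrow> e \<le> dist x y" and "\<delta> < e" "0 \<le> s"
  shows "hausdorff_premeasure s \<delta> A + hausdorff_premeasure s \<delta> B \<le> hausdorff_premeasure s \<delta> (A \<union> B)"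
proof (rule le_hausdorff_premeasure)
  fix U :: "nat \<Rightarrow> 'a set"
  assume U: "A \<union> B \<subseteq> (\<Union>n. U n)" "\<And>n. bounded (U n)" "\<And>n. diameter (U n) \<le> \<delta>"
  have le: "hausdorff_premeasure s \<delta> C \<le> (\<Sum>n. diam_power s (U n \<inter> C))" if "C \<subseteq> A \<union> B" for C
  proof (rule hausdorff_premeasure_le)
    show "C \<subseteq> (\<Union>n. U n \<inter> C)" using that U(1) by auto
    fix n
    show "bounded (U n \<inter> C)" using U(2)[of n] by auto
    have "diameter (U n \<inter> C) \<le> diameter (U n)" using U(2)[of n] by (intro diameter_subset) auto
    then show "diameter (U n \<inter> C) \<le> \<delta>" using U(3)[of n] by simp
  qed
  have "hausdorff_premeasure s \<delta> A + hausdorff_premeasure s \<delta> B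
      \<le> (\<Sum>n. diam_power s (U n \<inter> A)) + (\<Sum>n. diam_power s (U n \<inter> B))"
    by (intro add_mono le) auto
  also have "\<dots> = (\<Sum>n. diam_power s (U n \<inter> A) + diam_power s (U n \<inter> B))"
    by (simp add: suminf_add)
  also have "\<dots> \<le> (\<Sum>n. diam_power s (U n))"
  proof (intro suminf_le)
    fix n
    have "U n \<inter> A = {} \<or> U n \<inter> B = {}"
    proof (rule ccontr)
      assume "\<not> ?thesis"
      then obtain x y where xy: "x \<in> U n" "x \<in> A" "y \<in> U n" "y \<in> B" by blast
      have "dist x y \<le> diameter (U n)" using U(2) xy by (intro diameter_bounded_bound) auto
      then show False using sep[OF xy(2,4)] U(3)[of n] \<open>\<delta> < e\<close> by linarith
    qed
    then show "diam_power s (U n \<inter> A) + diam_power s (U n \<inter> B) \<le> diam_power s (U n)"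
      using U(2) \<open>0 \<le> s\<close> by (auto intro!: diam_power_mono)
  qed auto
  finally show "hausdorff_premeasure s \<delta> A + hausdorff_premeasure s \<delta> B \<le> (\<Sum>n. diam_power s (U n))" .
qed

text \<open>The metric outer measure property, which here takes the place of Caratheodory
  measurability. Two independent scales are compared first, because the two suprema are pulled out
  one after the other.\<close>

lemma hausdorff_measure_separated:
  assumes sep: "\<And>x y. x \<in> A \<Longrightarrow> y \<in> B \<Longrightarrow> e \<le> dist x y" and "0 < e" "0 \<le> s"
  shows "hausdorff_measure s A + hausdorff_measure s B \<le> hausdorff_measure s (A \<union> B)"
proof -
  have *: "hausdorff_premeasure s \<delta> A + hausdorff_premeasure s \<epsilon> B \<le> hausdorff_measure s (A \<union> B)"
    if "0 < \<delta>" "0 < \<epsilon>" for \<delta> \<epsilon>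
  proof -
    \<comment> \<open>Below both scales, so both premeasures only grow, and strictly below the gap
      \<open>e\<close>, so that covers split.\<close>
    define d where "d = min (e / 2) (min \<delta> \<epsilon>)"
    have d: "0 < d" "d < e" "d \<le> \<delta>" "d \<le> \<epsilon>" using that \<open>0 < e\<close> by (auto simp: d_def)
    have "hausdorff_premeasure s \<delta> A + hausdorff_premeasure s \<epsilon> B
        \<le> hausdorff_premeasure s d A + hausdorff_premeasure s d B"
      using d by (intro add_mono hausdorff_premeasure_antimono)
    also have "\<dots> \<le> hausdorff_premeasure s d (A \<union> B)"
      by (rule hausdorff_premeasure_separated[OF sep d(2) \<open>0 \<le> s\<close>])
    also have "\<dots> \<le> hausdorff_measure s (A \<union> B)" using d by (intro hausdorff_premeasure_le_measure)
    finally show ?thesis .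
  qed
  have "hausdorff_premeasure s \<delta> A + hausdorff_measure s B \<le> hausdorff_measure s (A \<union> B)" if "0 < \<delta>" for \<delta>
    unfolding hausdorff_measure_def[of s B]
    by (subst ennreal_SUP_add_right) (auto intro!: SUP_least * that)
  then show ?thesis
    unfolding hausdorff_measure_def[of s A]
    by (subst ennreal_SUP_add_left[symmetric]) (auto intro!: SUP_least)
qed

text \<open>Disjoint compact sets have positive distance, so the separated case can be applied one
  set at a time.\<close>

lemma sum_hausdorff_measure_disjoint_compact:
  fixes C :: "'i \<Rightarrow> 'a::heine_borel set"
  assumes "finite I" "\<And>i. i \<in> I \<Longrightarrow> compact (C i)" "disjoint_family_on C I" "0 \<le> s"
  shows "(\<Sum>i\<in>I. hausdorff_measure s (C i)) \<le> hausdorff_measure s (\<Union>i\<in>I. C i)"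
  using assms
proof (induction I rule: finite_induct)
  case (insert i I)
  have "compact (\<Union>j\<in>I. C j)" using insert by (intro compact_UN) auto
  moreover have "C i \<inter> (\<Union>j\<in>I. C j) = {}"
    using insert.hyps insert.prems(2) by (auto simp: disjoint_family_on_def)
  ultimately have "\<exists>d>0. \<forall>x\<in>C i. \<forall>y\<in>(\<Union>j\<in>I. C j). d \<le> dist x y"
    using insert.prems(1) by (intro separate_compact_closed compact_imp_closed) auto
  then obtain d where d: "0 < d" "\<And>x y. x \<in> C i \<Longrightarrow> y \<in> (\<Union>j\<in>I. C j) \<Longrightarrow> d \<le> dist x y"
    by auto
  have "(\<Sum>j\<in>I. hausdorff_measure s (C j)) \<le> hausdorff_measure s (\<Union>j\<in>I. C j)"
    using insert.prems by (intro insert.IH) (auto simp: disjoint_family_on_def)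
  then have "(\<Sum>j\<in>insert i I. hausdorff_measure s (C j))
      \<le> hausdorff_measure s (C i) + hausdorff_measure s (\<Union>j\<in>I. C j)"
    using insert.hyps by (simp add: add_left_mono)
  also have "\<dots> \<le> hausdorff_measure s (C i \<union> (\<Union>j\<in>I. C j))"
    by (rule hausdorff_measure_separated[OF d(2,1) \<open>0 \<le> s\<close>])
  finally show ?case by simp
qed simp

section \<open>Words of an iterated function system\<close>

text \<open>The first letter acts last. Appending letters on the right therefore passes to a smaller
  cylinder, and concatenation of words becomes composition of maps.\<close>

definition word_map :: "(nat \<Rightarrow> 'a \<Rightarrow> 'a) \<Rightarrow> nat list \<Rightarrow> 'a \<Rightarrow> 'a" where
  "word_map S w = foldr (\<lambda>i f. S i \<circ> f) w id"

definition word_ratio :: "(nat \<Rightarrow> real) \<Rightarrow> nat list \<Rightarrow> real" where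
  "word_ratio r w = prod_list (map r w)"

definition word_rotation ::
  "(nat \<Rightarrow> 'a::real_normed_vector \<Rightarrow>\<^sub>L 'a) \<Rightarrow> nat list \<Rightarrow> 'a \<Rightarrow>\<^sub>L 'a" where
  "word_rotation T w = foldr (\<lambda>i B. T i o\<^sub>L B) w id_blinfun"

lemma word_map_simps [simp]:
  "word_map S [] = id" "word_map S (i # w) = S i \<circ> word_map S w"
  "word_map S (u @ w) = word_map S u \<circ> word_map S w"
  by (simp_all add: word_map_def) (induction u; simp add: comp_assoc)

lemma word_ratio_simps [simp]:
  "word_ratio r [] = 1" "word_ratio r (i # w) = r i * word_ratio r w"
  "word_ratio r (u @ w) = word_ratio r u * word_ratio r w"
  by (simp_all add: word_ratio_def)

lemma blinfun_compose_id_left [simp]: "id_blinfun o\<^sub>L A = A"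
  by (rule blinfun_eqI) simp

lemma blinfun_compose_id_right [simp]: "A o\<^sub>L id_blinfun = A"
  by (rule blinfun_eqI) simp

lemma blinfun_compose_assoc: "(A o\<^sub>L B) o\<^sub>L C = A o\<^sub>L (B o\<^sub>L C)"
  by (rule blinfun_eqI) simp

lemma word_rotation_simps [simp]:
  "word_rotation T [] = id_blinfun" "word_rotation T (i # w) = T i o\<^sub>L word_rotation T w"
  "word_rotation T (u @ w) = word_rotation T u o\<^sub>L word_rotation T w"
  by (simp_all add: word_rotation_def) (induction u; simp add: blinfun_compose_assoc)

section \<open>Orthogonal operators\<close>

lemma norm_orthogonal_compose:
  fixes A :: "'a::euclidean_space \<Rightarrow>\<^sub>L 'a"
  assumes "orthogonal_transformation (blinfun_apply A)"
  shows "norm (A o\<^sub>L B) = norm B"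
  unfolding norm_blinfun.rep_eq onorm_def
  using assms by (simp add: orthogonal_transformation_norm)

lemma norm_compose_orthogonal_le:
  fixes A :: "'a::euclidean_space \<Rightarrow>\<^sub>L 'a"
  assumes "orthogonal_transformation (blinfun_apply A)"
  shows "norm (B o\<^sub>L A) \<le> norm B"
proof (rule norm_blinfun_bound)
  fix x
  have "norm (blinfun_apply B (blinfun_apply A x)) \<le> norm B * norm (blinfun_apply A x)"
    by (rule norm_blinfun)
  then show "norm (blinfun_apply (B o\<^sub>L A) x) \<le> norm B * norm x"
    using assms by (simp add: orthogonal_transformation_norm)
qed simp

lemma orthogonal_blinfun_inverse:
  fixes A :: "'a::euclidean_space \<Rightarrow>\<^sub>L 'a"
  assumes "orthogonal_transformation (blinfun_apply A)"
  shows "\<exists>B. orthogonal_transformation (blinfun_apply B) \<and> A o\<^sub>L B = id_blinfun \<and> B o\<^sub>L A = id_blinfun"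
proof -
  interpret group "orthogonal_group :: ('a \<Rightarrow>\<^sub>L 'a) monoid" by (rule group_orthogonal_group)
  have "A \<in> carrier orthogonal_group" using assms by (simp add: orthogonal_group_def)
  then show ?thesis using r_inv[of A] l_inv[of A] inv_closed[of A]
    by (auto simp: orthogonal_group_def)
qed

text \<open>A linear map is orthogonal iff it preserves every norm, and each of these conditions is
  closed in the operator norm.\<close>

lemma closed_orthogonal_blinfun:
  "closed {A :: 'a::euclidean_space \<Rightarrow>\<^sub>L 'a. orthogonal_transformation (blinfun_apply A)}"
proof -
  have "closed {A :: 'a \<Rightarrow>\<^sub>L 'a. \<forall>x. norm (blinfun_apply A x) = norm x}"
    by (intro closed_Collect_all closed_Collect_eq continuous_intros)
  moreover have "linear (blinfun_apply A)" for A :: "'a \<Rightarrow>\<^sub>L 'a"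
    by (simp add: blinfun.bounded_linear_right bounded_linear.linear)
  ultimately show ?thesis by (simp add: orthogonal_transformation)
qed

locale self_similar_set =
  fixes m :: nat and S :: "nat \<Rightarrow> 'a::euclidean_space \<Rightarrow> 'a" and r :: "nat \<Rightarrow> real"
    and T :: "nat \<Rightarrow> 'a \<Rightarrow>\<^sub>L 'a" and v :: "nat \<Rightarrow> 'a" and K :: "'a set"
  assumes ifs: "ss_ifs m S r T v"
    and attractor: "is_attractor m S K"
    and nontrivial: "\<exists>x\<in>K. \<exists>y\<in>K. x \<noteq> y"
begin

definition words :: "nat list set" where "words = lists {1..m}"
abbreviation "Sw \<equiv> word_map S"
abbreviation "rw \<equiv> word_ratio r"
abbreviation "Tw \<equiv> word_rotation T"

lemma words_simps [simp]:
  "[] \<in> words" "i # w \<in> words \<longleftrightarrow> i \<in> {1..m} \<and> w \<in> words"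
  "u @ w \<in> words \<longleftrightarrow> u \<in> words \<and> w \<in> words"
  by (auto simp: words_def)

lemma compact_K: "compact K" and K_nonempty: "K \<noteq> {}" and K_eq: "K = (\<Union>i\<in>{1..m}. S i ` K)"
  using attractor unfolding is_attractor_def by auto

lemma rw_pos: "w \<in> words \<Longrightarrow> 0 < rw w"
  using ifs by (induction w) (auto simp: ss_ifs_def)

lemma orthogonal_Tw: "w \<in> words \<Longrightarrow> orthogonal_transformation (blinfun_apply (Tw w))"
proof (induction w)
  case (Cons i w)
  then have "orthogonal_transformation (blinfun_apply (T i) \<circ> blinfun_apply (Tw w))"
    using ifs by (intro orthogonal_transformation_compose) (auto simp: ss_ifs_def orthogonal_group_def)
  then show ?case by (simp add: comp_def blinfun_compose.rep_eq)
qed (simp add: orthogonal_transformation_def linear_iff)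

text \<open>Writing the translation part as the value at 0 avoids a third quantity defined by
  recursion over words.\<close>

lemma Sw_affine: "w \<in> words \<Longrightarrow> Sw w x = rw w *\<^sub>R blinfun_apply (Tw w) x + Sw w 0"
proof (induction w)
  case (Cons i w)
  then have i: "S i x = r i *\<^sub>R blinfun_apply (T i) x + v i" for x
    using ifs by (auto simp: ss_ifs_def)
  show ?case
    using Cons by (simp add: i blinfun.bilinear_simps algebra_simps)
qed simp

lemma dist_Sw: "w \<in> words \<Longrightarrow> dist (Sw w x) (Sw w y) = rw w * dist x y"
proof -
  assume w: "w \<in> words"
  have "Sw w x - Sw w y = rw w *\<^sub>R blinfun_apply (Tw w) (x - y)"
    by (subst (1 2) Sw_affine[OF w]) (simp add: blinfun.bilinear_simps algebra_simps)
  then show ?thesis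
    using orthogonal_Tw[OF w] rw_pos[OF w] by (simp add: dist_norm orthogonal_transformation_norm)
qed

lemma Sw_subset_K: "w \<in> words \<Longrightarrow> Sw w ` K \<subseteq> K"
proof (induction w)
  case (Cons i w)
  have "Sw (i # w) ` K = S i ` Sw w ` K" by (simp add: image_comp)
  also have "\<dots> \<subseteq> S i ` K" using Cons by (intro image_mono) auto
  also have "\<dots> \<subseteq> K" using Cons.prems by (subst (2) K_eq) auto
  finally show ?case .
qed simp

lemma continuous_Sw:
  assumes "w \<in> words"
  shows "continuous_on A (Sw w)"
proof -
  have eq: "Sw w = (\<lambda>x. rw w *\<^sub>R blinfun_apply (Tw w) x + Sw w 0)"
    by (rule ext) (rule Sw_affine[OF assms])
  show ?thesis by (subst eq) (intro continuous_intros)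
qed

lemma compact_Sw_K: "w \<in> words \<Longrightarrow> compact (Sw w ` K)"
  by (intro compact_continuous_image continuous_Sw compact_K)

lemma K_covered_by_cylinders: "x \<in> K \<Longrightarrow> \<exists>w\<in>words. length w = n \<and> x \<in> Sw w ` K"
proof (induction n arbitrary: x)
  case 0
  then show ?case by (intro bexI[of _ "[]"]) auto
next
  case (Suc n)
  obtain i y where iy: "i \<in> {1..m}" "y \<in> K" "x = S i y" using Suc.prems by (subst (asm) K_eq) auto
  obtain w z where w: "w \<in> words" "length w = n" "z \<in> K" "y = Sw w z" using Suc.IH[OF iy(2)] by auto
  show ?case using iy w by (intro bexI[of _ "i # w"]) auto
qed

lemma rw_le_power: "\<exists>\<rho><1. 0 \<le> \<rho> \<and> (\<forall>w\<in>words. rw w \<le> \<rho> ^ length w)"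
proof (intro exI conjI ballI)
  \<comment> \<open>Inserting 0 keeps the maximum meaningful without a prior proof that
    \<open>m\<close> is positive, and gives nonnegativity.\<close>
  define \<rho> where "\<rho> = Max (insert 0 (r ` {1..m}))"
  show "\<rho> < 1" using ifs by (auto simp: \<rho>_def ss_ifs_def)
  show \<rho>: "0 \<le> \<rho>" by (auto simp: \<rho>_def)
  fix w assume "w \<in> words"
  then show "rw w \<le> \<rho> ^ length w"
  proof (induction w)
    case (Cons i w)
    then have "0 \<le> rw w" using rw_pos[of w] by auto
    moreover have "i \<in> {1..m}" using Cons.prems by simp
    then have "r i \<le> \<rho>" unfolding \<rho>_def by (intro Max_ge) auto
    ultimately show ?case using Cons \<rho> by (auto intro!: mult_mono)
  qed simp
qed

lemma small_cylinder:
  assumes "x \<in> K" "0 < e"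
  shows "\<exists>w\<in>words. x \<in> Sw w ` K \<and> rw w < e"
proof -
  obtain \<rho> where \<rho>: "\<rho> < 1" "0 \<le> \<rho>" "\<forall>w\<in>words. rw w \<le> \<rho> ^ length w" using rw_le_power by auto
  obtain n where "\<rho> ^ n < e" using real_arch_pow_inv[OF assms(2) \<rho>(1)] by auto
  moreover obtain w where "w \<in> words" "length w = n" "x \<in> Sw w ` K"
    using K_covered_by_cylinders[OF assms(1), of n] by auto
  ultimately show ?thesis using \<rho>(3) by (intro bexI[of _ w]) auto
qed

lemma rw_le_1:
  assumes "w \<in> words"
  shows "rw w \<le> 1"
proof -
  obtain \<rho> where \<rho>: "\<rho> < 1" "0 \<le> \<rho>" "\<forall>w\<in>words. rw w \<le> \<rho> ^ length w" using rw_le_power by auto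
  then have "rw w \<le> \<rho> ^ length w" using assms by blast
  also have "\<dots> \<le> 1" using \<rho> by (intro power_le_one) auto
  finally show ?thesis .
qed

section \<open>The closure of the word rotations as a compact group\<close>

text \<open>Only products of generators enter, without inverses, because these are the rotations
  that cylinders of \<open>K\<close> realise. That the closure is nevertheless a group is shown in
  \<open>rotations_inverse\<close>.\<close>

definition rotations :: "('a \<Rightarrow>\<^sub>L 'a) set" where
  "rotations = closure (Tw ` words)"

lemma Tw_in_rotations: "w \<in> words \<Longrightarrow> Tw w \<in> rotations"
  unfolding rotations_def by (rule subsetD[OF closure_subset]) (rule imageI)

lemma id_in_rotations: "id_blinfun \<in> rotations"
  using Tw_in_rotations[of "[]"] by simp

lemma closed_rotations: "closed rotations"
  by (simp add: rotations_def)

lemma orthogonal_rotations: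
  assumes "Q \<in> rotations"
  shows "orthogonal_transformation (blinfun_apply Q)"
proof -
  have "rotations \<subseteq> {A. orthogonal_transformation (blinfun_apply A)}"
    unfolding rotations_def
    by (rule closure_minimal[OF _ closed_orthogonal_blinfun]) (use orthogonal_Tw in blast)
  then show ?thesis using assms by blast
qed

lemma rotations_approx:
  assumes "Q \<in> rotations" "0 < e"
  shows "\<exists>w\<in>words. norm (Tw w - Q) < e"
  using assms unfolding rotations_def closure_approachable by (auto simp: dist_norm)

lemma compact_rotations: "compact rotations"
proof -
  have "norm Q \<le> 1" if "Q \<in> rotations" for Q
    using orthogonal_rotations[OF that]
    by (intro norm_blinfun_bound) (auto simp: orthogonal_transformation_norm)
  then have "bounded rotations" unfolding bounded_iff by blast
  then show ?thesis using closed_rotations by (simp add: compact_eq_bounded_closed)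
qed

lemma rotations_compose:
  assumes "P \<in> rotations" "Q \<in> rotations"
  shows "P o\<^sub>L Q \<in> rotations"
proof -
  have "\<exists>R\<in>Tw ` words. dist R (P o\<^sub>L Q) < e" if e: "0 < e" for e
  proof -
    obtain u where u: "u \<in> words" "norm (Tw u - P) < e / 2"
      using rotations_approx[OF assms(1), of "e / 2"] e by auto
    obtain w where w: "w \<in> words" "norm (Tw w - Q) < e / 2"
      using rotations_approx[OF assms(2), of "e / 2"] e by auto
    \<comment> \<open>The error is split so that one part is composed with the isometry
      \<open>Tw u\<close> on the left and the other with the isometry \<open>Q\<close> on the right;
      neither composition increases the norm.\<close>
    have "Tw (u @ w) - (P o\<^sub>L Q) = (Tw u o\<^sub>L (Tw w - Q)) + ((Tw u - P) o\<^sub>L Q)"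
      by (rule blinfun_eqI) (simp add: blinfun.bilinear_simps)
    then have "norm (Tw (u @ w) - (P o\<^sub>L Q)) \<le> norm (Tw u o\<^sub>L (Tw w - Q)) + norm ((Tw u - P) o\<^sub>L Q)"
      by (simp only: norm_triangle_ineq)
    also have "\<dots> < e"
      using u w norm_orthogonal_compose[OF orthogonal_Tw[OF u(1)], of "Tw w - Q"]
        norm_compose_orthogonal_le[OF orthogonal_rotations[OF assms(2)], of "Tw u - P"] by linarith
    finally show ?thesis using u w by (intro bexI[of _ "Tw (u @ w)"] imageI) (auto simp: dist_norm)
  qed
  then have "\<forall>e>0. \<exists>R\<in>Tw ` words. dist R (P o\<^sub>L Q) < e" by (intro allI impI)
  then show ?thesis by (simp only: rotations_def closure_approachable)
qed

text \<open>A closed subsemigroup of a compact group contains inverses: some powers of \<open>Q\<close> approximate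
  the identity, and the preceding powers approximate the inverse.\<close>

lemma rotations_inverse:
  assumes Q: "Q \<in> rotations" and PQ: "P o\<^sub>L Q = id_blinfun" "orthogonal_transformation (blinfun_apply P)"
  shows "P \<in> rotations"
proof -
  define p where "p n = ((o\<^sub>L) Q ^^ n) id_blinfun" for n
  have p_Suc: "p (Suc n) = Q o\<^sub>L p n" for n by (simp add: p_def)
  have p_add: "p (i + j) = p i o\<^sub>L p j" for i j
    by (induction i) (simp_all add: p_def blinfun_compose_assoc)
  have p: "p n \<in> rotations" for n
    using rotations_compose[OF Q] by (induction n) (auto simp: p_def id_in_rotations)
  have "\<exists>R\<in>rotations. dist R P < e" if e: "0 < e" for e
  proof -
    have "\<exists>l\<in>rotations. \<exists>f. strict_mono f \<and> (p \<circ> f) \<longlonglongrightarrow> l"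
      by (rule compact_rotations[unfolded compact_def, rule_format]) (rule p)
    then obtain l f where f: "strict_mono f" "(p \<circ> f) \<longlonglongrightarrow> l" by auto
    have "\<exists>N. \<forall>i\<ge>N. \<forall>j\<ge>N. dist ((p \<circ> f) i) ((p \<circ> f) j) < e"
      by (rule metric_CauchyD[OF LIMSEQ_imp_Cauchy[OF f(2)] e])
    then obtain N where N: "\<And>i j. N \<le> i \<Longrightarrow> N \<le> j \<Longrightarrow> dist ((p \<circ> f) i) ((p \<circ> f) j) < e"
      by auto
    \<comment> \<open>With this choice \<open>p (f (Suc N))\<close> is \<open>p (f N)\<close>
      composed with \<open>Q\<close> and \<open>p k\<close>. Cancelling the isometries
      \<open>p (f N)\<close> and \<open>Q\<close> on the left turns closeness of two terms of the
      Cauchy sequence into closeness of \<open>p k\<close> to \<open>P\<close>; \<open>k\<close> may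
      be 0.\<close>
    define k where "k = f (Suc N) - f N - 1"
    have "f N < f (Suc N)" using f(1) by (simp add: strict_mono_def)
    then have k: "f (Suc N) = f N + Suc k" by (simp add: k_def)
    have "p (f (Suc N)) - p (f N) = p (f N) o\<^sub>L (Q o\<^sub>L (p k - P))"
    proof -
      have "Q o\<^sub>L P = id_blinfun"
        using PQ orthogonal_blinfun_inverse[OF orthogonal_rotations[OF Q]]
        by (metis blinfun_compose_assoc blinfun_compose_id_left blinfun_compose_id_right)
      then have "p (f N) o\<^sub>L (Q o\<^sub>L (p k - P)) = p (f N) o\<^sub>L (p (Suc k) - id_blinfun)"
        by (simp add: p_Suc bounded_bilinear.diff_right[OF bounded_bilinear_blinfun_compose])
      also have "\<dots> = p (f (Suc N)) - p (f N)"
        unfolding k p_add by (simp add: bounded_bilinear.diff_right[OF bounded_bilinear_blinfun_compose])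
      finally show ?thesis by simp
    qed
    then have "norm (p k - P) = norm (p (f (Suc N)) - p (f N))"
      using norm_orthogonal_compose orthogonal_rotations p Q by metis
    also have "\<dots> < e" using N[of "Suc N" N] by (simp add: dist_norm)
    finally show ?thesis using p[of k] by (auto simp: dist_norm)
  qed
  then show ?thesis using closed_rotations by (metis closed_approachable)
qed

text \<open>Generators are rotations of one-letter words, and \<open>rotations\<close> is closed
  under products, inverses and limits. From here on every \<open>Q\<close> in the theorem can be
  approximated by rotations of actual cylinders.\<close>

lemma closed_transformation_group_subset: "closed_transformation_group m T \<subseteq> rotations"
proof -
  have T: "T i \<in> rotations" if "i \<in> {1..m}" for i
    using Tw_in_rotations[of "[i]"] that by simp
  interpret group "orthogonal_group :: ('a \<Rightarrow>\<^sub>L 'a) monoid" by (rule group_orthogonal_group)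
  have "Q \<in> rotations" if "Q \<in> generate orthogonal_group (T ` {1..m})" for Q
    using that
  proof (induction rule: generate.induct)
    case one
    then show ?case by (simp add: orthogonal_group_def id_in_rotations)
  next
    case (incl h)
    then show ?case using T by auto
  next
    case (inv h)
    then have h: "h \<in> rotations" using T by auto
    then have "h \<in> carrier orthogonal_group" by (simp add: orthogonal_group_def orthogonal_rotations)
    then show ?case using l_inv[of h] inv_closed[of h]
      by (intro rotations_inverse[OF h]) (auto simp: orthogonal_group_def)
  next
    case (eng h1 h2)
    then show ?case by (simp add: orthogonal_group_def rotations_compose)
  qed
  then have "transformation_group m T \<subseteq> rotations" by (auto simp: transformation_group_def)
  then have "closure (transformation_group m T) \<subseteq> rotations"
    using closed_rotations by (rule closure_minimal)
  then show ?thesis by (auto simp: closed_transformation_group_def)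
qed

text \<open>To turn the rotation of \<open>w\<close> into \<open>Q\<close>, aim at the inverse of
  \<open>Tw w\<close> followed on the right by \<open>Q\<close>; it lies in
  \<open>rotations\<close>, so a point of a finite net is close to it, and composing with the
  isometry \<open>Tw w\<close> preserves the error. What matters is that \<open>V\<close> does not
  depend on \<open>w\<close>: appending a word of \<open>V\<close> then costs only a bounded factor
  in the ratio.\<close>

lemma rotations_finite_net:
  assumes Q: "Q \<in> rotations" and "0 < e"
  shows "\<exists>V\<subseteq>words. finite V \<and> (\<forall>w\<in>words. \<exists>u\<in>V. norm (Tw (w @ u) - Q) < e)"
proof -
  have "rotations \<subseteq> (\<Union>u\<in>words. ball (Tw u) e)"
  proof
    fix P assume "P \<in> rotations"
    then obtain u where "u \<in> words" "norm (Tw u - P) < e" using rotations_approx \<open>0 < e\<close> by metis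
    then show "P \<in> (\<Union>u\<in>words. ball (Tw u) e)" by (auto simp: dist_norm)
  qed
  then obtain V where V: "V \<subseteq> words" "finite V" "rotations \<subseteq> (\<Union>u\<in>V. ball (Tw u) e)"
    by (rule compactE_image[OF compact_rotations open_ball]) (rule that)
  have "\<exists>u\<in>V. norm (Tw (w @ u) - Q) < e" if w: "w \<in> words" for w
  proof -
    obtain B where B: "orthogonal_transformation (blinfun_apply B)" "Tw w o\<^sub>L B = id_blinfun"
        "B o\<^sub>L Tw w = id_blinfun"
      using orthogonal_blinfun_inverse[OF orthogonal_Tw[OF w]] by auto
    have "B \<in> rotations" by (rule rotations_inverse[OF Tw_in_rotations[OF w] B(3,1)])
    then have "B o\<^sub>L Q \<in> rotations" using Q by (rule rotations_compose)
    then obtain u where u: "u \<in> V" "norm (Tw u - (B o\<^sub>L Q)) < e" using V(3) by (auto simp: dist_norm)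
    have "Tw (w @ u) - Q = Tw w o\<^sub>L (Tw u - (B o\<^sub>L Q))"
      using B(2) by (simp add: bounded_bilinear.diff_right[OF bounded_bilinear_blinfun_compose]
          flip: blinfun_compose_assoc)
    then have "norm (Tw (w @ u) - Q) < e"
      using u norm_orthogonal_compose[OF orthogonal_Tw[OF w]] by metis
    then show ?thesis using u by blast
  qed
  then show ?thesis using V by blast
qed

end

section \<open>Disjoint cylinders and the dimension\<close>

context self_similar_set
begin

lemma bounded_K: "bounded K"
  using compact_K by (rule compact_imp_bounded)

lemma diameter_K_pos: "0 < diameter K"
proof -
  obtain x y where "x \<in> K" "y \<in> K" "x \<noteq> y" using nontrivial by auto
  then show ?thesis using diameter_bounded_bound[OF bounded_K, of x y]
    by (metis dist_pos_lt order_less_le_trans)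
qed

lemma diameter_Sw_K_le:
  assumes "w \<in> words" "x \<in> Sw w ` K" "y \<in> Sw w ` K"
  shows "dist x y \<le> rw w * diameter K"
  using assms rw_pos[OF assms(1)]
  by (auto simp: dist_Sw intro!: mult_left_mono diameter_bounded_bound bounded_K)

text \<open>Pulling a covering set back along the similarity divides its diameter by the ratio.
  Intersecting with \<open>K\<close> makes the preimage empty, hence of contribution 0, when
  \<open>U\<close> misses the cylinder.\<close>

lemma diam_power_preimage_le:
  assumes "w \<in> words" "bounded U" "0 \<le> s"
  shows "ennreal (rw w powr s) * diam_power s {x \<in> K. Sw w x \<in> U} \<le> diam_power s U"
proof (cases "s = 0 \<or> {x \<in> K. Sw w x \<in> U} = {}")
  case True
  then show ?thesis using rw_pos[OF assms(1)] by (auto simp: diam_power_def)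
next
  case False
  let ?V = "{x \<in> K. Sw w x \<in> U}"
  have bV: "bounded ?V" using bounded_K by (rule bounded_subset) auto
  have r: "0 < rw w" by (rule rw_pos[OF assms(1)])
  have "diameter ?V \<le> diameter U / rw w"
  proof (rule diameter_leI)
    fix x y assume "x \<in> ?V" "y \<in> ?V"
    then have "dist (Sw w x) (Sw w y) \<le> diameter U"
      using assms by (intro diameter_bounded_bound) auto
    then show "dist x y \<le> diameter U / rw w"
      using r assms(1) by (simp add: dist_Sw field_simps)
  qed (use r diameter_ge_0[OF assms(2)] in auto)
  then have "rw w * diameter ?V \<le> diameter U" using r by (simp add: field_simps)
  then have "(rw w * diameter ?V) powr s \<le> diameter U powr s"
    using r assms(3) diameter_ge_0[OF bV] by (intro powr_mono2) auto
  then have "rw w powr s * diameter ?V powr s \<le> diameter U powr s"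
    using r diameter_ge_0[OF bV] by (simp add: powr_mult)
  then show ?thesis using False assms(3)
    by (auto simp: diam_power_pos_exponent ennreal_mult[symmetric] intro!: ennreal_leI)
qed

definition disjoint_cylinders :: "nat list set \<Rightarrow> bool" where
  "disjoint_cylinders F \<longleftrightarrow> finite F \<and> F \<subseteq> words \<and> disjoint_family_on (\<lambda>w. Sw w ` K) F"

lemma disjoint_cylinders_gap:
  assumes "disjoint_cylinders F"
  shows "\<exists>g>0. \<forall>w\<in>F. \<forall>u\<in>F. w \<noteq> u \<longrightarrow> (\<forall>x\<in>Sw w ` K. \<forall>y\<in>Sw u ` K. g \<le> dist x y)"
proof -
  define P where "P = {(w, u). w \<in> F \<and> u \<in> F \<and> w \<noteq> u}"
  have "P \<subseteq> F \<times> F" by (auto simp: P_def)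
  then have P: "finite P" using assms by (auto simp: disjoint_cylinders_def intro: finite_subset)
  have "\<exists>d>0. \<forall>x\<in>Sw (fst p) ` K. \<forall>y\<in>Sw (snd p) ` K. d \<le> dist x y" if "p \<in> P" for p
  proof -
    have *: "fst p \<in> F" "snd p \<in> F" "fst p \<noteq> snd p" using that by (auto simp: P_def)
    then have "fst p \<in> words" "snd p \<in> words" "Sw (fst p) ` K \<inter> Sw (snd p) ` K = {}"
      using assms unfolding disjoint_cylinders_def disjoint_family_on_def by blast+
    then show ?thesis by (intro separate_compact_closed compact_imp_closed compact_Sw_K)
  qed
  then obtain d where d: "\<And>p. p \<in> P \<Longrightarrow> 0 < d p"
      "\<And>p x y. p \<in> P \<Longrightarrow> x \<in> Sw (fst p) ` K \<Longrightarrow> y \<in> Sw (snd p) ` K \<Longrightarrow> d p \<le> dist x y"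
    by metis
  \<comment> \<open>Inserting 1 keeps the minimum meaningful when there is no pair of distinct
    cylinders.\<close>
  define g where "g = Min (insert 1 (d ` P))"
  have "0 < g" using P d(1) by (auto simp: g_def)
  moreover have "g \<le> d p" if "p \<in> P" for p using P that by (auto simp: g_def)
  then have "g \<le> dist x y" if "w \<in> F" "u \<in> F" "w \<noteq> u" "x \<in> Sw w ` K" "y \<in> Sw u ` K" for w u x y
    using d(2)[of "(w, u)" x y] that by (fastforce simp: P_def)
  ultimately show ?thesis by auto
qed

text \<open>A finite cover of \<open>K\<close> none of whose sets meets two cylinders of \<open>F\<close> splits into
  smaller covers of the cylinders; pulling these back to \<open>K\<close> gives the induction.\<close>

lemma finite_cover_lower_bound:
  fixes U :: "nat \<Rightarrow> 'a set"
  assumes F: "disjoint_cylinders F" and card: "2 \<le> card F" and s: "0 \<le> s"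
    and sum: "1 \<le> (\<Sum>w\<in>F. rw w powr s)" and g: "0 < g"
    and gap: "\<And>w u x y. w \<in> F \<Longrightarrow> u \<in> F \<Longrightarrow> w \<noteq> u \<Longrightarrow> x \<in> Sw w ` K \<Longrightarrow> y \<in> Sw u ` K \<Longrightarrow> g \<le> dist x y"
    and I: "finite I" "K \<subseteq> (\<Union>i\<in>I. U i)" "\<And>i. i \<in> I \<Longrightarrow> bounded (U i)"
  shows "ennreal (g powr s) \<le> (\<Sum>i\<in>I. diam_power s (U i))"
  using I
proof (induction I arbitrary: U rule: finite_psubset_induct)
  case (psubset I)
  have F': "finite F" "\<And>w. w \<in> F \<Longrightarrow> w \<in> words" using F by (auto simp: disjoint_cylinders_def)
  show ?case
  proof (cases "\<exists>i\<in>I. \<exists>w\<in>F. \<exists>u\<in>F. w \<noteq> u \<and> U i \<inter> Sw w ` K \<noteq> {} \<and> U i \<inter> Sw u ` K \<noteq> {}")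
    \<comment> \<open>A single covering set bridging two cylinders has diameter at least the gap
      \<open>g\<close> and already pays for the whole bound.\<close>
    case True
    then obtain i w u x y where *: "i \<in> I" "w \<in> F" "u \<in> F" "w \<noteq> u" "x \<in> U i" "x \<in> Sw w ` K"
      "y \<in> U i" "y \<in> Sw u ` K" by blast
    have "g \<le> dist x y" by (rule gap) (use * in auto)
    also have "\<dots> \<le> diameter (U i)" using * psubset.prems by (intro diameter_bounded_bound) auto
    finally have "g powr s \<le> diameter (U i) powr s" using g s by (intro powr_mono2) auto
    then have "ennreal (g powr s) \<le> diam_power s (U i)"
      using * g by (auto simp: diam_power_def intro!: ennreal_leI)
    also have "\<dots> \<le> (\<Sum>i\<in>I. diam_power s (U i))"
      using * psubset.hyps by (intro member_le_sum) auto
    finally show ?thesis .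
  next
    case False
    define J where "J w = {i \<in> I. U i \<inter> Sw w ` K \<noteq> {}}" for w
    have J_disj: "J w \<inter> J u = {}" if "w \<in> F" "u \<in> F" "w \<noteq> u" for w u
      using False that unfolding J_def by blast
    have J_ne: "J w \<noteq> {}" if "w \<in> F" for w
    proof -
      obtain x where "x \<in> K" using K_nonempty by auto
      then have "Sw w x \<in> K" using Sw_subset_K[OF F'(2)[OF that]] by auto
      then obtain i where "i \<in> I" "Sw w x \<in> U i" using psubset.prems(1) by auto
      then have "i \<in> J w" using \<open>x \<in> K\<close> by (auto simp: J_def)
      then show ?thesis by auto
    qed
    \<comment> \<open>This is where \<open>F\<close> needs two members: another cylinder uses up at
      least one covering set, so the cover of each cylinder is strictly smaller and the induction
      applies.\<close>
    have J_sub: "J w \<subset> I" if w: "w \<in> F" for w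
    proof -
      have "\<not> F \<subseteq> {w}" using card card_mono[of "{w}" F] by auto
      then obtain u where "u \<in> F" "u \<noteq> w" by auto
      then have "J u \<noteq> {}" "J w \<inter> J u = {}" using J_ne J_disj w by auto
      moreover have "J u \<subseteq> I" "J w \<subseteq> I" by (auto simp: J_def)
      ultimately show ?thesis by auto
    qed
    have step: "ennreal (rw w powr s) * ennreal (g powr s) \<le> (\<Sum>i\<in>J w. diam_power s (U i))"
      if w: "w \<in> F" for w
    proof -
      have "ennreal (g powr s) \<le> (\<Sum>i\<in>J w. diam_power s {x \<in> K. Sw w x \<in> U i})"
      proof (rule psubset.IH[OF J_sub[OF w]])
        show "K \<subseteq> (\<Union>i\<in>J w. {x \<in> K. Sw w x \<in> U i})"
        proof
          fix x assume x: "x \<in> K"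
          then have "Sw w x \<in> K" using Sw_subset_K[OF F'(2)[OF w]] by auto
          then obtain i where "i \<in> I" "Sw w x \<in> U i" using psubset.prems(1) by auto
          then show "x \<in> (\<Union>i\<in>J w. {x \<in> K. Sw w x \<in> U i})" using x by (auto simp: J_def)
        qed
      qed (auto intro: bounded_subset[OF bounded_K])
      then have "ennreal (rw w powr s) * ennreal (g powr s)
          \<le> ennreal (rw w powr s) * (\<Sum>i\<in>J w. diam_power s {x \<in> K. Sw w x \<in> U i})"
        by (rule mult_left_mono) simp
      also have "\<dots> = (\<Sum>i\<in>J w. ennreal (rw w powr s) * diam_power s {x \<in> K. Sw w x \<in> U i})"
        by (simp add: sum_distrib_left)
      also have "\<dots> \<le> (\<Sum>i\<in>J w. diam_power s (U i))"
        using w F' psubset.prems s by (intro sum_mono diam_power_preimage_le) (auto simp: J_def)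
      finally show ?thesis .
    qed
    have "ennreal (g powr s) \<le> ennreal (\<Sum>w\<in>F. rw w powr s) * ennreal (g powr s)"
      using sum mult_right_mono[of 1 "ennreal (\<Sum>w\<in>F. rw w powr s)" "ennreal (g powr s)"] by simp
    also have "\<dots> = (\<Sum>w\<in>F. ennreal (rw w powr s) * ennreal (g powr s))"
      by (simp add: sum_distrib_right flip: sum_ennreal)
    also have "\<dots> \<le> (\<Sum>w\<in>F. \<Sum>i\<in>J w. diam_power s (U i))" by (intro sum_mono step)
    also have "\<dots> = (\<Sum>i\<in>(\<Union>w\<in>F. J w). diam_power s (U i))"
      using F' psubset.hyps J_disj by (intro sum.UNION_disjoint[symmetric]) (auto simp: J_def)
    also have "\<dots> \<le> (\<Sum>i\<in>I. diam_power s (U i))"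
      using psubset.hyps by (intro sum_mono2) (auto simp: J_def)
    finally show ?thesis .
  qed
qed

text \<open>A mass distribution bound without a mass: a cheap cover can be made open and then finite
  by compactness of \<open>K\<close>, and finite covers cost at least the gap between the cylinders
  to the power \<open>s\<close>.\<close>

lemma hausdorff_measure_pos_of_disjoint_cylinders:
  assumes F: "disjoint_cylinders F" "2 \<le> card F" "0 \<le> s" "1 \<le> (\<Sum>w\<in>F. rw w powr s)"
  shows "0 < hausdorff_measure s K"
proof -
  obtain g where g: "0 < g"
      "\<And>w u x y. w \<in> F \<Longrightarrow> u \<in> F \<Longrightarrow> w \<noteq> u \<Longrightarrow> x \<in> Sw w ` K \<Longrightarrow> y \<in> Sw u ` K \<Longrightarrow> g \<le> dist x y"
    using disjoint_cylinders_gap[OF F(1)] by metis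
  have "\<not> hausdorff_premeasure s 1 K < ennreal (g powr s)"
  proof
    assume "hausdorff_premeasure s 1 K < ennreal (g powr s)"
    then obtain U :: "nat \<Rightarrow> 'a set" where U: "K \<subseteq> (\<Union>n. U n)" "\<And>n. open (U n)" "\<And>n. bounded (U n)"
      "(\<Sum>n. diam_power s (U n)) < ennreal (g powr s)"
      using hausdorff_premeasure_lessD_open[of s 1 K "ennreal (g powr s)" 2] F(3) by auto
    obtain I where I: "finite I" "K \<subseteq> (\<Union>n\<in>I. U n)"
      using compactE_image[OF compact_K, of UNIV U] U by metis
    have "ennreal (g powr s) \<le> (\<Sum>n\<in>I. diam_power s (U n))"
      by (rule finite_cover_lower_bound[OF F g I U(3)])
    also have "\<dots> \<le> (\<Sum>n. diam_power s (U n))" using I by (intro sum_le_suminf) auto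
    finally show False using U(4) by simp
  qed
  then have "ennreal (g powr s) \<le> hausdorff_measure s K"
    using hausdorff_premeasure_le_measure[of 1 s K] by (meson le_less_trans not_le zero_less_one)
  then show ?thesis using g(1)
    by (metis ennreal_less_zero_iff less_le_trans powr_gt_zero less_numeral_extra(3))
qed

text \<open>Ratios are at most 1, so lowering the exponent only increases the sum; the same family
  makes the measure positive for every smaller exponent too.\<close>

lemma hausdorff_dim_ge_of_disjoint_cylinders:
  assumes F: "disjoint_cylinders F" "2 \<le> card F" "0 \<le> s" "1 \<le> (\<Sum>w\<in>F. rw w powr s)"
  shows "ereal s \<le> hausdorff_dim K"
  unfolding hausdorff_dim_def
proof (rule INF_greatest)
  fix s' assume s': "s' \<in> {s. 0 \<le> s \<and> hausdorff_measure s K = 0}"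
  have "\<not> s' < s"
  proof
    assume "s' < s"
    have "(\<Sum>w\<in>F. rw w powr s) \<le> (\<Sum>w\<in>F. rw w powr s')"
      using \<open>s' < s\<close> F(1) rw_pos rw_le_1
      by (intro sum_mono powr_mono') (auto simp: disjoint_cylinders_def intro: less_imp_le)
    then have "0 < hausdorff_measure s' K"
      using F s' by (intro hausdorff_measure_pos_of_disjoint_cylinders[of F]) auto
    then show False using s' by simp
  qed
  then show "ereal s \<le> ereal s'" by simp
qed

text \<open>A sum above 1 at exponent \<open>t\<close> stays above 1 at a slightly larger exponent
  by continuity, which would push the dimension beyond \<open>t\<close>. This bound does the work of
  a separation condition.\<close>

lemma sum_disjoint_cylinders_le_1:
  assumes F: "disjoint_cylinders F" and t: "ereal t = hausdorff_dim K"
  shows "(\<Sum>w\<in>F. rw w powr t) \<le> 1"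
proof (rule ccontr)
  assume *: "\<not> ?thesis"
  have F': "finite F" "\<And>w. w \<in> F \<Longrightarrow> w \<in> words" using F by (auto simp: disjoint_cylinders_def)
  have "0 \<le> hausdorff_dim K" unfolding hausdorff_dim_def by (rule INF_greatest) auto
  then have t0: "0 \<le> t" by (simp flip: t)
  have le1: "rw w powr t \<le> 1" if "w \<in> F" for w
    using powr_mono2[OF t0, of "rw w" 1] rw_le_1[OF F'(2)[OF that]] rw_pos[OF F'(2)[OF that]] by simp
  \<comment> \<open>Each summand is at most 1, so a sum above 1 needs at least two
    cylinders.\<close>
  have card: "2 \<le> card F"
  proof (rule ccontr)
    assume "\<not> 2 \<le> card F"
    then have "card F \<le> 1" by simp
    moreover have "(\<Sum>w\<in>F. rw w powr t) \<le> real (card F) * 1"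
      using le1 by (intro sum_bounded_above) auto
    ultimately show False using * by simp
  qed
  have "((\<lambda>s. \<Sum>w\<in>F. rw w powr s) \<longlongrightarrow> (\<Sum>w\<in>F. rw w powr t)) (at_right t)"
    using rw_pos F' by (intro tendsto_intros) (auto simp: less_imp_neq[symmetric])
  then have "\<forall>\<^sub>F s in at_right t. 1 < (\<Sum>w\<in>F. rw w powr s)"
    using * by (intro order_tendstoD(1)) auto
  moreover have "\<forall>\<^sub>F s in at_right t. t < s" by (simp add: eventually_at_right_less)
  ultimately have "\<forall>\<^sub>F s in at_right t. 1 < (\<Sum>w\<in>F. rw w powr s) \<and> t < s"
    by eventually_elim auto
  then obtain s where s: "1 < (\<Sum>w\<in>F. rw w powr s)" "t < s"
    using eventually_happens[of _ "at_right t"] trivial_limit_at_right_real by blast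
  have "ereal s \<le> hausdorff_dim K"
    using s t0 by (intro hausdorff_dim_ge_of_disjoint_cylinders[OF F card]) auto
  then show False using s by (simp flip: t)
qed

text \<open>Two distinct points of \<open>K\<close> lie in disjoint small cylinders; at exponent 0
  this pair would have sum 2.\<close>

lemma hausdorff_dim_pos:
  assumes t: "ereal t = hausdorff_dim K"
  shows "0 < t"
proof (rule ccontr)
  assume *: "\<not> 0 < t"
  have "0 \<le> hausdorff_dim K" unfolding hausdorff_dim_def by (rule INF_greatest) auto
  then have t0: "t = 0" using * by (simp flip: t)
  obtain x y where xy: "x \<in> K" "y \<in> K" "x \<noteq> y" using nontrivial by auto
  \<comment> \<open>Cylinders of ratio below \<open>e\<close> have diameter below half the distance
    of \<open>x\<close> and \<open>y\<close>, so the two cannot share a point.\<close>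
  define e where "e = dist x y / (2 * diameter K)"
  have e: "0 < e" using xy diameter_K_pos by (simp add: e_def)
  obtain w where w: "w \<in> words" "x \<in> Sw w ` K" "rw w < e" using small_cylinder[OF xy(1) e] by auto
  obtain u where u: "u \<in> words" "y \<in> Sw u ` K" "rw u < e" using small_cylinder[OF xy(2) e] by auto
  have disj: "Sw w ` K \<inter> Sw u ` K = {}"
  proof (rule ccontr)
    assume "\<not> ?thesis"
    then obtain z where z: "z \<in> Sw w ` K" "z \<in> Sw u ` K" by auto
    have "dist x y \<le> dist x z + dist z y" by (rule dist_triangle)
    also have "\<dots> \<le> rw w * diameter K + rw u * diameter K"
      by (intro add_mono diameter_Sw_K_le w u z)
    also have "\<dots> < e * diameter K + e * diameter K"
      using w u diameter_K_pos by (intro add_strict_mono mult_strict_right_mono) auto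
    also have "\<dots> = dist x y" using diameter_K_pos by (simp add: e_def field_simps)
    finally show False by simp
  qed
  have "w \<noteq> u" using disj w(2) by auto
  have "disjoint_cylinders {w, u}"
    using disj w u by (auto simp: disjoint_cylinders_def disjoint_family_on_def)
  from sum_disjoint_cylinders_le_1[OF this t] show False
    using \<open>w \<noteq> u\<close> rw_pos[OF w(1)] rw_pos[OF u(1)] t0 by simp
qed

text \<open>Around each point of the open part of \<open>K\<close> take a small cylinder through it
  and the ball whose radius is the ratio times \<open>diameter K\<close>, which contains the
  cylinder. Vitali selects disjoint balls whose 5-fold enlargements cover; these have diameter at
  most 10 times the radius, whence the constant. Disjoint balls give disjoint cylinders.\<close>

lemma disjoint_cylinders_of_measure:
  assumes t: "0 < t" and "open U" "0 < d" and a: "a < hausdorff_measure t (K \<inter> U)"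
  shows "\<exists>F. disjoint_cylinders F \<and> (\<forall>w\<in>F. Sw w ` K \<subseteq> U \<and> rw w < d) \<and>
    a < ennreal ((10 * diameter K) powr t * (\<Sum>w\<in>F. rw w powr t))"
proof -
  let ?D = "diameter K"
  note D = diameter_K_pos
  obtain \<delta> where \<delta>: "0 < \<delta>" "a < hausdorff_premeasure t \<delta> (K \<inter> U)"
    using a unfolding hausdorff_measure_def less_SUP_iff by auto
  have "\<exists>w\<in>words. x \<in> Sw w ` K \<and> Sw w ` K \<subseteq> U \<and> rw w < d \<and> 10 * rw w * ?D \<le> \<delta>"
    if x: "x \<in> K \<inter> U" for x
  proof -
    obtain e where e: "0 < e" "ball x e \<subseteq> U" using x \<open>open U\<close> by (meson IntD2 openE)
    \<comment> \<open>The three bounds give the prescribed size, make the enlarged ball admissible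
      at scale \<delta>, and keep the cylinder inside \<open>ball x e\<close>.\<close>
    have "0 < min d (min (\<delta> / (10 * ?D)) (e / ?D))" using e \<delta> D \<open>0 < d\<close> by auto
    then obtain w where w: "w \<in> words" "x \<in> Sw w ` K" "rw w < min d (min (\<delta> / (10 * ?D)) (e / ?D))"
      using small_cylinder x by (metis IntD1)
    then have "10 * rw w * ?D \<le> \<delta>" "rw w * ?D < e" using D by (auto simp: field_simps)
    moreover have "Sw w ` K \<subseteq> ball x e"
      using diameter_Sw_K_le[OF w(1,2)] \<open>rw w * ?D < e\<close> by fastforce
    ultimately show ?thesis using w e by (intro bexI[of _ w]) auto
  qed
  then obtain f where f: "\<And>x. x \<in> K \<inter> U \<Longrightarrow> f x \<in> words" "\<And>x. x \<in> K \<inter> U \<Longrightarrow> x \<in> Sw (f x) ` K"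
      "\<And>x. x \<in> K \<inter> U \<Longrightarrow> Sw (f x) ` K \<subseteq> U" "\<And>x. x \<in> K \<inter> U \<Longrightarrow> rw (f x) < d"
      "\<And>x. x \<in> K \<inter> U \<Longrightarrow> 10 * rw (f x) * ?D \<le> \<delta>"
    by metis
  define \<rho> where "\<rho> x = rw (f x) * ?D" for x
  have \<rho>: "0 < \<rho> x" "\<rho> x \<le> \<delta>" "2 * (5 * \<rho> x) \<le> \<delta>" if "x \<in> K \<inter> U" for x
  proof -
    show "0 < \<rho> x" using rw_pos[OF f(1)[OF that]] D by (simp add: \<rho>_def)
    then show "\<rho> x \<le> \<delta>" "2 * (5 * \<rho> x) \<le> \<delta>" using f(5)[OF that] by (auto simp: \<rho>_def)
  qed
  have f_sub: "Sw (f x) ` K \<subseteq> cball x (\<rho> x)" if "x \<in> K \<inter> U" for x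
    using diameter_Sw_K_le[OF f(1,2)[OF that]] by (auto simp: \<rho>_def)
  have cover0: "K \<inter> U \<subseteq> (\<Union>x\<in>K \<inter> U. cball x (\<rho> x))" using \<rho>(1) by force
  obtain C where C: "countable C" "C \<subseteq> K \<inter> U"
      "pairwise (\<lambda>i j. disjnt (cball i (\<rho> i)) (cball j (\<rho> j))) C"
      "K \<inter> U \<subseteq> (\<Union>x\<in>C. cball x (5 * \<rho> x))"
    by (rule Vitali_covering_lemma_cballs[OF cover0, of \<delta>]) (use \<rho> in auto)
  \<comment> \<open>Covers are sequences, whereas the Vitali family \<open>C\<close> may be finite
    or infinite. Indexing it by a subset \<open>J\<close> of the naturals, with empty sets
    elsewhere, treats both cases at once.\<close>
  define J where "J = to_nat_on C ` C"
  define c where "c = from_nat_into C"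
  have c: "c n \<in> C" if "n \<in> J" for n using that C(1) by (auto simp: J_def c_def)
  have c_inj: "inj_on c J" using C(1) by (auto simp: inj_on_def J_def c_def)
  have C_eq: "C = c ` J" using C(1) by (auto simp: J_def c_def image_iff)
  define V where "V n = (if n \<in> J then cball (c n) (5 * \<rho> (c n)) else {})" for n
  define q where "q n = (if n \<in> J then (10 * ?D) powr t * rw (f (c n)) powr t else 0)" for n
  have c': "c n \<in> K \<inter> U" if "n \<in> J" for n using c[OF that] C(2) by auto
  have diamV: "diameter (V n) \<le> 10 * \<rho> (c n)" if "n \<in> J" for n
    using \<rho>(1)[OF c'[OF that]] that by (simp add: V_def)
  have "hausdorff_premeasure t \<delta> (K \<inter> U) \<le> (\<Sum>n. diam_power t (V n))"
  proof (rule hausdorff_premeasure_le)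
    show "K \<inter> U \<subseteq> (\<Union>n. V n)"
    proof
      fix x assume "x \<in> K \<inter> U"
      then obtain n where "n \<in> J" "x \<in> cball (c n) (5 * \<rho> (c n))" using C(4) C_eq by auto
      then have "x \<in> V n" by (simp add: V_def)
      then show "x \<in> (\<Union>n. V n)" by blast
    qed
    show "bounded (V n)" for n by (simp add: V_def)
    show "diameter (V n) \<le> \<delta>" for n
      using diamV[of n] \<rho>(3)[OF c'[of n]] \<delta>(1) by (cases "n \<in> J") (auto simp: V_def)
  qed
  also have "\<dots> \<le> (\<Sum>n. ennreal (q n))"
  proof (intro suminf_le)
    fix n
    show "diam_power t (V n) \<le> ennreal (q n)"
    proof (cases "n \<in> J")
      case True
      have "diameter (V n) powr t \<le> (10 * \<rho> (c n)) powr t"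
        using diamV[OF True] t by (intro powr_mono2 diameter_ge_0) (auto simp: V_def)
      also have "\<dots> = q n"
        using True rw_pos[OF f(1)[OF c'[OF True]]] D by (simp add: q_def \<rho>_def powr_mult)
      finally show ?thesis using t by (simp add: diam_power_pos_exponent ennreal_leI)
    qed (simp add: V_def)
  qed auto
  finally have "a < (\<Sum>n. ennreal (q n))" using \<delta>(2) by simp
  \<comment> \<open>The strict inequality survives for a finite partial sum, which is what yields a
    finite family.\<close>
  then obtain N where N: "a < (\<Sum>n<N. ennreal (q n))"
    unfolding suminf_eq_SUP less_SUP_iff by auto
  define F where "F = (f \<circ> c) ` ({..<N} \<inter> J)"
  have disj: "Sw (f x) ` K \<inter> Sw (f y) ` K = {}" if "x \<in> C" "y \<in> C" "x \<noteq> y" for x y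
  proof -
    have "cball x (\<rho> x) \<inter> cball y (\<rho> y) = {}"
      using C(3) that by (auto simp: pairwise_def disjnt_def)
    then show ?thesis using f_sub[of x] f_sub[of y] that C(2) by blast
  qed
  \<comment> \<open>Distinct centres have disjoint nonempty cylinders, hence distinct words, so the
    sum over centres may be read as a sum over \<open>F\<close>.\<close>
  have f_inj: "inj_on f C"
  proof (rule inj_onI, rule ccontr)
    fix x y assume "x \<in> C" "y \<in> C" "f x = f y" "x \<noteq> y"
    then show False using disj[of x y] f(2)[of x] C(2) by auto
  qed
  have inj: "inj_on (f \<circ> c) ({..<N} \<inter> J)"
    using c_inj f_inj C_eq by (intro comp_inj_on) (auto intro: inj_on_subset)
  have "disjoint_cylinders F"
    unfolding disjoint_cylinders_def
  proof (intro conjI)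
    show "finite F" by (simp add: F_def)
    show "F \<subseteq> words" using f(1) c' by (auto simp: F_def)
    show "disjoint_family_on (\<lambda>w. Sw w ` K) F"
      unfolding disjoint_family_on_def F_def
      by (auto simp del: image_Int_subset) (metis c disj disjoint_iff image_eqI)
  qed
  moreover have "\<forall>w\<in>F. Sw w ` K \<subseteq> U \<and> rw w < d"
    unfolding F_def using f(3,4) c' by auto
  moreover have "(\<Sum>n<N. ennreal (q n)) = ennreal ((10 * ?D) powr t * (\<Sum>w\<in>F. rw w powr t))"
  proof -
    have "(\<Sum>n<N. ennreal (q n)) = ennreal (\<Sum>n<N. q n)"
      by (rule sum_ennreal) (auto simp: q_def)
    also have "(\<Sum>n<N. q n) = (\<Sum>n\<in>{..<N} \<inter> J. (10 * ?D) powr t * rw (f (c n)) powr t)"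
      by (simp add: q_def sum.inter_restrict)
    also have "\<dots> = (10 * ?D) powr t * (\<Sum>w\<in>F. rw w powr t)"
      unfolding F_def by (subst sum.reindex[OF inj]) (simp add: sum_distrib_left)
    finally show ?thesis .
  qed
  ultimately show ?thesis using N by auto
qed

lemma hausdorff_measure_K_finite:
  assumes t: "ereal t = hausdorff_dim K"
  shows "hausdorff_measure t K < \<infinity>"
proof -
  have "\<not> ennreal ((10 * diameter K) powr t) < hausdorff_measure t (K \<inter> UNIV)"
  proof
    assume "ennreal ((10 * diameter K) powr t) < hausdorff_measure t (K \<inter> UNIV)"
    then obtain F where F: "disjoint_cylinders F"
      "ennreal ((10 * diameter K) powr t) < ennreal ((10 * diameter K) powr t * (\<Sum>w\<in>F. rw w powr t))"
      using disjoint_cylinders_of_measure[OF hausdorff_dim_pos[OF t] open_UNIV zero_less_one] by metis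
    have "(10 * diameter K) powr t * (\<Sum>w\<in>F. rw w powr t) \<le> (10 * diameter K) powr t"
      using sum_disjoint_cylinders_le_1[OF F(1) t] by (simp add: mult_left_le)
    then show False using F(2) by (meson ennreal_leI not_le)
  qed
  then have "hausdorff_measure t K \<le> ennreal ((10 * diameter K) powr t)" by simp
  then show ?thesis by (rule le_less_trans) (simp add: less_top)
qed

end

section \<open>Hausdorff measure on linear images\<close>

text \<open>Error terms below arise as a small number times a fixed finite quantity. Dividing the
  tolerance by \<open>c + 1\<close> rather than \<open>c\<close> also covers
  \<open>b = 0\<close>.\<close>

lemma ennreal_le_vanishing:
  fixes x a b :: ennreal
  assumes "\<And>e::real. 0 < e \<Longrightarrow> x \<le> a + ennreal e * b" "b < \<infinity>"
  shows "x \<le> a"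
proof (rule ennreal_le_epsilon)
  fix e :: real assume "0 < e"
  define c where "c = enn2real b"
  have c: "b = ennreal c" "0 \<le> c" using assms(2) by (auto simp: c_def)
  have "x \<le> a + ennreal (e / (c + 1)) * b" using \<open>0 < e\<close> c by (intro assms(1)) auto
  also have "ennreal (e / (c + 1)) * b = ennreal (e / (c + 1) * c)"
    unfolding c(1) using \<open>0 < e\<close> c(2) by (intro ennreal_mult[symmetric]) auto
  also have "\<dots> \<le> ennreal e"
    using \<open>0 < e\<close> c by (intro ennreal_leI) (simp add: field_simps)
  finally show "x \<le> a + ennreal e" by (simp add: add_left_mono)
qed

locale self_similar_measure = self_similar_set m S r T v K
  for m :: nat and S :: "nat \<Rightarrow> 'a::euclidean_space \<Rightarrow> 'a" and r T v K +
  fixes t :: real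
  assumes dim: "ereal t = hausdorff_dim K" and measure_K_pos: "0 < hausdorff_measure t K"
begin

lemma t_pos: "0 < t"
  using dim by (rule hausdorff_dim_pos)

lemma measure_finite: "A \<subseteq> K \<Longrightarrow> hausdorff_measure t A < \<infinity>"
  by (rule le_less_trans[OF hausdorff_measure_mono hausdorff_measure_K_finite[OF dim]])

lemma measure_Sw_K: "w \<in> words \<Longrightarrow> hausdorff_measure t (Sw w ` K) = ennreal (rw w powr t) * hausdorff_measure t K"
  using t_pos by (intro hausdorff_measure_similarity) (auto simp: dist_Sw rw_pos)

text \<open>Converts sums of ratio powers back into measure, by superadditivity on disjoint compact
  sets; it is the counterpart of the Vitali estimate, but without a loss of constant.\<close>

lemma measure_disjoint_cylinders:
  assumes "disjoint_cylinders F" "\<And>w. w \<in> F \<Longrightarrow> Sw w ` K \<subseteq> A"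
  shows "ennreal (\<Sum>w\<in>F. rw w powr t) * hausdorff_measure t K \<le> hausdorff_measure t A"
proof -
  have F: "finite F" "F \<subseteq> words" "disjoint_family_on (\<lambda>w. Sw w ` K) F"
    using assms(1) by (auto simp: disjoint_cylinders_def)
  have "ennreal (\<Sum>w\<in>F. rw w powr t) * hausdorff_measure t K = (\<Sum>w\<in>F. hausdorff_measure t (Sw w ` K))"
    using F by (simp add: sum_distrib_right measure_Sw_K subset_iff flip: sum_ennreal)
  also have "\<dots> \<le> hausdorff_measure t (\<Union>w\<in>F. Sw w ` K)"
    using F t_pos by (intro sum_hausdorff_measure_disjoint_compact) (auto intro: compact_Sw_K)
  also have "\<dots> \<le> hausdorff_measure t A"
    using assms(2) by (intro hausdorff_measure_mono) auto
  finally show ?thesis .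
qed

text \<open>A Vitali-type exhaustion. A family nearly maximizing the sum of \<open>(rw w) powr t\<close> works:
  if it left out too much of \<open>K \<inter> U\<close>, further cylinders, extended by one of
  finitely many words to turn their rotation close to \<open>Q\<close>, could be added.\<close>

lemma cylinder_exhaustion:
  assumes "open U" "Q \<in> rotations" "0 < e" "0 < d" "0 < \<eta>"
  shows "\<exists>F. disjoint_cylinders F \<and>
    (\<forall>w\<in>F. Sw w ` K \<subseteq> U \<and> rw w < d \<and> norm (Tw w - Q) < e) \<and>
    hausdorff_measure t (K \<inter> U - (\<Union>w\<in>F. Sw w ` K)) \<le> ennreal \<eta>"
proof -
  define \<F> where "\<F> = {F. disjoint_cylinders F \<and>
    (\<forall>w\<in>F. Sw w ` K \<subseteq> U \<and> rw w < d \<and> norm (Tw w - Q) < e)}"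
  define val where "val F = (\<Sum>w\<in>F. rw w powr t)" for F
  obtain V where V: "V \<subseteq> words" "finite V" "\<And>w. w \<in> words \<Longrightarrow> \<exists>u\<in>V. norm (Tw (w @ u) - Q) < e"
    using rotations_finite_net[OF assms(2,3)] by auto
  obtain f where f: "\<And>w. w \<in> words \<Longrightarrow> f w \<in> V" "\<And>w. w \<in> words \<Longrightarrow> norm (Tw (w @ f w) - Q) < e"
    using V(3) by metis
  \<comment> \<open>The largest shrinking that appending a word of the finite net can cause.\<close>
  define \<rho> where "\<rho> = Min (insert 1 (rw ` V))"
  have \<rho>: "0 < \<rho>" using V rw_pos by (auto simp: \<rho>_def)
  have \<rho>_le: "\<rho> \<le> rw (f w)" if "w \<in> words" for w
    using V(2) f(1)[OF that] by (auto simp: \<rho>_def)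
  define c where "c = (10 * diameter K) powr t"
  have c: "0 < c" using diameter_K_pos by (simp add: c_def)
  \<comment> \<open>If more than \<eta> of measure were left over, the Vitali selection would give
    ratio powers summing to more than \<eta> / \<open>c\<close>, and turning the rotations costs at
    most the factor \<open>\<rho> powr t\<close>. So \<theta> is a guaranteed gain, and coming
    within \<theta> of the supremum excludes it.\<close>
  define \<theta> where "\<theta> = \<rho> powr t * \<eta> / c"
  have \<theta>: "0 < \<theta>" using \<rho> c assms by (simp add: \<theta>_def)
  have empty: "{} \<in> \<F>" by (auto simp: \<F>_def disjoint_cylinders_def disjoint_family_on_def)
  have bdd: "bdd_above (val ` \<F>)"
    using sum_disjoint_cylinders_le_1[OF _ dim] by (intro bdd_aboveI[of _ 1]) (auto simp: val_def \<F>_def)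
  have "(SUP F\<in>\<F>. val F) - \<theta> < (SUP F\<in>\<F>. val F)" using \<theta> by simp
  then obtain F where F: "F \<in> \<F>" "(SUP F\<in>\<F>. val F) - \<theta> < val F"
    using less_cSUP_iff[OF _ bdd] empty by blast
  have max: "val F' < val F + \<theta>" if "F' \<in> \<F>" for F'
    using cSUP_upper[OF that bdd] F(2) by linarith
  have F': "disjoint_cylinders F" "finite F" "F \<subseteq> words" "disjoint_family_on (\<lambda>w. Sw w ` K) F"
    using F(1) by (auto simp: \<F>_def disjoint_cylinders_def)
  \<comment> \<open>Finitely many compact cylinders are removed, so the rest is open again;
    cylinders found inside it are automatically disjoint from those of \<open>F\<close>.\<close>
  define U' where "U' = U - (\<Union>w\<in>F. Sw w ` K)"
  have "compact (\<Union>w\<in>F. Sw w ` K)" using F' by (intro compact_UN compact_Sw_K) auto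
  then have "open U'" unfolding U'_def using assms(1) by (intro open_Diff compact_imp_closed)
  have "\<not> ennreal \<eta> < hausdorff_measure t (K \<inter> U')"
  proof
    assume "ennreal \<eta> < hausdorff_measure t (K \<inter> U')"
    then obtain G where G: "disjoint_cylinders G" "\<And>w. w \<in> G \<Longrightarrow> Sw w ` K \<subseteq> U'" "\<And>w. w \<in> G \<Longrightarrow> rw w < d"
      "ennreal \<eta> < ennreal (c * (\<Sum>w\<in>G. rw w powr t))"
      using disjoint_cylinders_of_measure[OF t_pos \<open>open U'\<close> assms(4), folded c_def] by metis
    have G': "finite G" "G \<subseteq> words" "disjoint_family_on (\<lambda>w. Sw w ` K) G"
      using G(1) by (auto simp: disjoint_cylinders_def)
    define h where "h w = w @ f w" for w
    have h: "h w \<in> words" "Sw (h w) ` K \<subseteq> Sw w ` K" "rw (h w) \<le> rw w" "\<rho> * rw w \<le> rw (h w)"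
      "norm (Tw (h w) - Q) < e" if "w \<in> G" for w
    proof -
      have w: "w \<in> words" using that G' by auto
      have fw: "f w \<in> words" using f(1)[OF w] V(1) by auto
      show "h w \<in> words" using w fw by (simp add: h_def)
      show "Sw (h w) ` K \<subseteq> Sw w ` K"
        using Sw_subset_K[OF fw] by (auto simp: h_def)
      show "rw (h w) \<le> rw w"
        using rw_le_1[OF fw] rw_pos[OF w] by (simp add: h_def mult_left_le)
      show "\<rho> * rw w \<le> rw (h w)"
        using \<rho>_le[OF w] rw_pos[OF w] by (simp add: h_def mult.commute)
      show "norm (Tw (h w) - Q) < e" using f(2)[OF w] by (simp add: h_def)
    qed
    have ne: "Sw w ` K \<noteq> {}" for w using K_nonempty by auto
    have h_disj: "Sw (h w) ` K \<inter> Sw (h u) ` K = {}" if "w \<in> G" "u \<in> G" "w \<noteq> u" for w u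
      using disjoint_family_onD[OF G'(3) that] h(2)[OF that(1)] h(2)[OF that(2)] by blast
    have inj: "inj_on h G"
    proof (rule inj_onI, rule ccontr)
      fix w u assume "w \<in> G" "u \<in> G" "h w = h u" "w \<noteq> u"
      then show False using h_disj[of w u] ne[of "h w"] by simp
    qed
    have FG_disj: "Sw w ` K \<inter> Sw (h u) ` K = {}" if "w \<in> F" "u \<in> G" for w u
      using h(2)[OF that(2)] G(2)[OF that(2)] that(1) unfolding U'_def by blast
    have FG: "F \<inter> h ` G = {}"
    proof (rule ccontr)
      assume "\<not> ?thesis"
      then obtain u where "h u \<in> F" "u \<in> G" by auto
      then show False using FG_disj[of "h u" u] ne[of "h u"] by simp
    qed
    have "F \<union> h ` G \<in> \<F>"
      unfolding \<F>_def disjoint_cylinders_def mem_Collect_eq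
    proof (intro conjI ballI)
      show "finite (F \<union> h ` G)" using F' G' by simp
      show "F \<union> h ` G \<subseteq> words" using F' h(1) by auto
      show "disjoint_family_on (\<lambda>w. Sw w ` K) (F \<union> h ` G)"
        unfolding disjoint_family_on_def
      proof (intro ballI impI)
        fix w u assume wu: "w \<in> F \<union> h ` G" "u \<in> F \<union> h ` G" "w \<noteq> u"
        consider "w \<in> F" "u \<in> F" | u' where "w \<in> F" "u' \<in> G" "u = h u'"
          | w' where "u \<in> F" "w' \<in> G" "w = h w'"
          | w' u' where "w' \<in> G" "u' \<in> G" "w = h w'" "u = h u'" using wu by blast
        then show "Sw w ` K \<inter> Sw u ` K = {}"
        proof cases
          case 1 then show ?thesis using disjoint_family_onD[OF F'(4)] wu by blast
        next
          case 2 then show ?thesis using FG_disj by blast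
        next
          case 3 then show ?thesis using FG_disj by blast
        next
          case 4
          then have "w' \<noteq> u'" using wu by auto
          then show ?thesis unfolding 4(3,4) using h_disj 4(1,2) by blast
        qed
      qed
      fix w assume "w \<in> F \<union> h ` G"
      then consider "w \<in> F" | u where "u \<in> G" "w = h u" by auto
      then have "Sw w ` K \<subseteq> U \<and> rw w < d \<and> norm (Tw w - Q) < e"
      proof cases
        case 1 then show ?thesis using F(1) by (auto simp: \<F>_def)
      next
        case 2
        have "Sw w ` K \<subseteq> U" unfolding 2(2) using h(2)[OF 2(1)] G(2)[OF 2(1)] unfolding U'_def by blast
        then show ?thesis using h(3,5)[OF 2(1)] G(3)[OF 2(1)] unfolding 2(2) by simp
      qed
      then show "Sw w ` K \<subseteq> U" "rw w < d" "norm (Tw w - Q) < e" by auto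
    qed
    then have "val (F \<union> h ` G) < val F + \<theta>" by (rule max)
    moreover have "val (F \<union> h ` G) = val F + (\<Sum>w\<in>G. rw (h w) powr t)"
      unfolding val_def using F' G' FG by (subst sum.union_disjoint) (auto simp: sum.reindex[OF inj])
    moreover have "\<theta> \<le> (\<Sum>w\<in>G. rw (h w) powr t)"
    proof -
      have "\<eta> < c * (\<Sum>w\<in>G. rw w powr t)" using G(4) assms(5) by (simp add: ennreal_less_iff)
      then have "\<rho> powr t * \<eta> \<le> \<rho> powr t * (c * (\<Sum>w\<in>G. rw w powr t))" by (intro mult_left_mono) auto
      then have "\<theta> \<le> \<rho> powr t * (\<Sum>w\<in>G. rw w powr t)" using c by (simp add: \<theta>_def field_simps)
      also have "\<dots> = (\<Sum>w\<in>G. (\<rho> * rw w) powr t)"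
        using \<rho> rw_pos G' by (auto simp: sum_distrib_left powr_mult intro!: sum.cong dest: less_imp_le)
      also have "\<dots> \<le> (\<Sum>w\<in>G. rw (h w) powr t)"
        using h(4) \<rho> rw_pos G' t_pos by (intro sum_mono powr_mono2) (auto intro!: mult_nonneg_nonneg less_imp_le)
      finally show ?thesis .
    qed
    ultimately show False by linarith
  qed
  moreover have "K \<inter> U' = K \<inter> U - (\<Union>w\<in>F. Sw w ` K)" by (auto simp: U'_def)
  ultimately show ?thesis using F(1) unfolding \<F>_def by (intro exI[of _ F]) (auto simp: not_less)
qed

text \<open>An almost optimal open cover of the compact set \<open>L\<close> of \<open>Q\<close> of
  \<open>K\<close> contains a neighbourhood of it, and a small change of the rotation, measured
  against the bound of \<open>L\<close> and the size of \<open>K\<close>, does not leave that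
  neighbourhood. The same cover serves both rotations; opening it costs the passage from
  \<open>D\<close> to \<open>2 * D\<close>.\<close>

lemma premeasure_rotation_upper_semicontinuous:
  fixes L :: "'a \<Rightarrow> 'b::euclidean_space"
  assumes L: "linear L" and fin: "hausdorff_premeasure t D (L ` blinfun_apply Q ` K) < \<infinity>"
    and "0 < D" "0 < \<epsilon>"
  shows "\<exists>e>0. \<forall>A. norm (A - Q) < e \<longrightarrow> hausdorff_premeasure t (2 * D) (L ` blinfun_apply A ` K)
    \<le> hausdorff_premeasure t D (L ` blinfun_apply Q ` K) + ennreal \<epsilon>"
proof -
  let ?P = "hausdorff_premeasure t D (L ` blinfun_apply Q ` K)"
  have "?P < ?P + ennreal \<epsilon>"
    using fin \<open>0 < \<epsilon>\<close> ennreal_add_left_cancel_less[of ?P 0 "ennreal \<epsilon>"] by (simp add: less_top)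
  from hausdorff_premeasure_lessD_open[OF this, of "2 * D"]
  obtain W where W: "L ` blinfun_apply Q ` K \<subseteq> (\<Union>n. W n)" "\<And>n. open (W n)" "\<And>n. bounded (W n)"
      "\<And>n. diameter (W n) \<le> 2 * D" "(\<Sum>n. diam_power t (W n)) < ?P + ennreal \<epsilon>"
    using \<open>0 < D\<close> t_pos by auto
  obtain B where B: "0 < B" "\<And>x. norm (L x) \<le> B * norm x" using linear_bounded_pos[OF L] by auto
  obtain R where R: "0 < R" "\<And>x. x \<in> K \<Longrightarrow> norm x \<le> R" using bounded_K bounded_pos by metis
  have "compact (L ` blinfun_apply Q ` K)"
    using L by (intro compact_continuous_image linear_continuous_on compact_K continuous_intros)
      (auto simp: linear_conv_bounded_linear)
  moreover have "open (\<Union>n. W n)" using W(2) by auto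
  ultimately obtain \<rho> where \<rho>: "0 < \<rho>" "(\<Union>y\<in>L ` blinfun_apply Q ` K. ball y \<rho>) \<subseteq> (\<Union>n. W n)"
    using W(1) by (rule compact_subset_open_imp_ball_epsilon_subset)
  define e where "e = \<rho> / (B * R)"
  have "0 < e" using \<rho> B R by (simp add: e_def)
  moreover have "hausdorff_premeasure t (2 * D) (L ` blinfun_apply A ` K) \<le> ?P + ennreal \<epsilon>"
    if A: "norm (A - Q) < e" for A
  proof -
    have "L (blinfun_apply A x) \<in> (\<Union>n. W n)" if x: "x \<in> K" for x
    proof -
      have "norm (L (blinfun_apply Q x) - L (blinfun_apply A x)) = norm (L (blinfun_apply (A - Q) x))"
        using L by (simp add: linear_diff[OF L] blinfun.bilinear_simps norm_minus_commute)
      also have "\<dots> \<le> B * norm (blinfun_apply (A - Q) x)" by (rule B(2))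
      also have "\<dots> \<le> B * (norm (A - Q) * norm x)"
        using B(1) by (intro mult_left_mono norm_blinfun) auto
      also have "\<dots> \<le> B * (norm (A - Q) * R)"
        using B(1) R(2)[OF x] by (intro mult_left_mono) auto
      also have "\<dots> < B * (e * R)"
        using A B(1) R(1) by (intro mult_strict_left_mono mult_strict_right_mono) auto
      also have "\<dots> = \<rho>" using B R by (simp add: e_def)
      finally have "L (blinfun_apply A x) \<in> ball (L (blinfun_apply Q x)) \<rho>" by (simp add: dist_norm)
      then show ?thesis using \<rho>(2) x by blast
    qed
    then have "hausdorff_premeasure t (2 * D) (L ` blinfun_apply A ` K) \<le> (\<Sum>n. diam_power t (W n))"
      using W(3,4) by (intro hausdorff_premeasure_le) auto
    then show ?thesis using W(5) by simp
  qed
  ultimately show ?thesis by blast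
qed

text \<open>Linearity lets scaling and translation pass through \<open>L\<close>; the rotation stays
  inside, which is why it has to be controlled.\<close>

lemma linear_image_Sw:
  assumes "linear L" "w \<in> words"
  shows "L ` Sw w ` K = (\<lambda>y. rw w *\<^sub>R y + L (Sw w 0)) ` L ` blinfun_apply (Tw w) ` K"
proof -
  have "L (Sw w x) = rw w *\<^sub>R L (blinfun_apply (Tw w) x) + L (Sw w 0)" for x
    by (subst Sw_affine[OF assms(2)]) (simp add: linear_add[OF assms(1)] linear_scale[OF assms(1)])
  then show ?thesis unfolding image_image by (intro image_cong refl)
qed

lemma premeasure_linear_image_le:
  fixes L :: "'a \<Rightarrow> 'b::euclidean_space"
  assumes L: "linear L" and Q: "Q \<in> rotations" and "open U" "0 < D"
  shows "hausdorff_measure t K * hausdorff_measure t (L ` (K \<inter> U))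
    \<le> hausdorff_premeasure t D (L ` blinfun_apply Q ` K) * hausdorff_measure t (K \<inter> U)"
proof -
  let ?M = "hausdorff_measure t K" and ?h = "hausdorff_measure t (K \<inter> U)"
  let ?P = "hausdorff_premeasure t D (L ` blinfun_apply Q ` K)"
  obtain B where B: "0 < B" "\<And>x. norm (L x) \<le> B * norm x" using linear_bounded_pos[OF L] by auto
  have lip: "dist (L x) (L y) \<le> B * dist x y" for x y
    using B(2)[of "x - y"] by (simp add: dist_norm linear_diff[OF L])
  have lip': "hausdorff_measure t (L ` A) \<le> ennreal (B powr t) * hausdorff_measure t A" for A
    using lip B t_pos by (intro hausdorff_measure_lipschitz) auto
  have P_fin: "?P < \<infinity>"
  proof -
    have "hausdorff_measure t (blinfun_apply Q ` K) \<le> ennreal (1 powr t) * ?M"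
      using t_pos orthogonal_rotations[OF Q]
      by (intro hausdorff_measure_lipschitz)
        (auto simp: dist_norm orthogonal_transformation_norm simp flip: blinfun.diff_right)
    then have "?P \<le> ennreal (B powr t) * ?M"
      using hausdorff_premeasure_le_measure[OF \<open>0 < D\<close>, of t "L ` blinfun_apply Q ` K"]
        lip'[of "blinfun_apply Q ` K"]
        mult_left_mono[of "hausdorff_measure t (blinfun_apply Q ` K)" ?M "ennreal (B powr t)"] by simp
    also have "\<dots> < \<infinity>" using measure_finite[of K] by (simp add: ennreal_mult_less_top)
    finally show ?thesis .
  qed
  have step: "?M * hausdorff_premeasure t \<delta> (L ` (K \<inter> U)) \<le> ?P * ?h" if \<delta>: "0 < \<delta>" for \<delta>
  proof (rule ennreal_le_vanishing)
    fix \<epsilon> :: real assume \<epsilon>: "0 < \<epsilon>"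
    obtain e where e: "0 < e" "\<And>A. norm (A - Q) < e \<Longrightarrow>
        hausdorff_premeasure t (2 * D) (L ` blinfun_apply A ` K) \<le> ?P + ennreal \<epsilon>"
      using premeasure_rotation_upper_semicontinuous[OF L P_fin \<open>0 < D\<close> \<epsilon>] by metis
    \<comment> \<open>Ratios below this bound shrink a cover of scale \<open>2 * D\<close> to scale
      \<delta>.\<close>
    have "0 < \<delta> / (2 * D)" using \<delta> \<open>0 < D\<close> by simp
    from cylinder_exhaustion[OF \<open>open U\<close> Q e(1) this \<epsilon>] obtain F where
      F: "disjoint_cylinders F" "\<And>w. w \<in> F \<Longrightarrow> Sw w ` K \<subseteq> U" "\<And>w. w \<in> F \<Longrightarrow> rw w < \<delta> / (2 * D)"
        "\<And>w. w \<in> F \<Longrightarrow> norm (Tw w - Q) < e"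
        "hausdorff_measure t (K \<inter> U - (\<Union>w\<in>F. Sw w ` K)) \<le> ennreal \<epsilon>"
      by auto
    have F': "finite F" "\<And>w. w \<in> F \<Longrightarrow> w \<in> words" using F(1) by (auto simp: disjoint_cylinders_def)
    \<comment> \<open>The part missed by the cylinders has measure at most \<epsilon>, and so by the
      Lipschitz bound has image of measure at most \<open>B powr t\<close> times \<epsilon>.\<close>
    define Z where "Z = K \<inter> U - (\<Union>w\<in>F. Sw w ` K)"
    have piece: "hausdorff_premeasure t \<delta> (L ` Sw w ` K) \<le> ennreal (rw w powr t) * (?P + ennreal \<epsilon>)"
      if w: "w \<in> F" for w
    proof -
      have r: "0 < rw w" by (rule rw_pos[OF F'(2)[OF w]])
      have "hausdorff_premeasure t (rw w * (\<delta> / rw w)) (L ` Sw w ` K)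
          \<le> ennreal (rw w powr t) * hausdorff_premeasure t (\<delta> / rw w) (L ` blinfun_apply (Tw w) ` K)"
        unfolding linear_image_Sw[OF L F'(2)[OF w]] using r t_pos
        by (intro hausdorff_premeasure_lipschitz) (auto simp: dist_norm simp flip: scaleR_diff_right)
      also have "\<dots> \<le> ennreal (rw w powr t) * (?P + ennreal \<epsilon>)"
      proof (rule mult_left_mono)
        have "2 * D \<le> \<delta> / rw w" using F(3)[OF w] r \<open>0 < D\<close> by (simp add: field_simps)
        then show "hausdorff_premeasure t (\<delta> / rw w) (L ` blinfun_apply (Tw w) ` K) \<le> ?P + ennreal \<epsilon>"
          using e(2)[OF F(4)[OF w]] by (rule order_trans[OF hausdorff_premeasure_antimono])
      qed simp
      finally show ?thesis using r by simp
    qed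
    have "K \<inter> U \<subseteq> (\<Union>w\<in>F. Sw w ` K) \<union> Z" by (auto simp: Z_def)
    then have "L ` (K \<inter> U) \<subseteq> L ` ((\<Union>w\<in>F. Sw w ` K) \<union> Z)" by (rule image_mono)
    also have "\<dots> = (\<Union>w\<in>F. L ` Sw w ` K) \<union> L ` Z" by (simp add: image_Un image_UN)
    finally have "hausdorff_premeasure t \<delta> (L ` (K \<inter> U))
        \<le> hausdorff_premeasure t \<delta> ((\<Union>w\<in>F. L ` Sw w ` K) \<union> L ` Z)"
      by (rule hausdorff_premeasure_mono)
    also have "\<dots> \<le> hausdorff_premeasure t \<delta> (\<Union>w\<in>F. L ` Sw w ` K) + hausdorff_premeasure t \<delta> (L ` Z)"
      using \<delta> by (intro hausdorff_premeasure_Un) simp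
    also have "\<dots> \<le> (\<Sum>w\<in>F. hausdorff_premeasure t \<delta> (L ` Sw w ` K)) + hausdorff_measure t (L ` Z)"
      using \<delta> F' by (intro add_mono hausdorff_premeasure_finite_subadditive hausdorff_premeasure_le_measure) auto
    also have "\<dots> \<le> (\<Sum>w\<in>F. ennreal (rw w powr t) * (?P + ennreal \<epsilon>)) + ennreal (B powr t) * ennreal \<epsilon>"
      using order_trans[OF lip'[of Z] mult_left_mono[OF F(5)[folded Z_def]]]
      by (intro add_mono sum_mono piece) auto
    also have "(\<Sum>w\<in>F. ennreal (rw w powr t) * (?P + ennreal \<epsilon>))
        = ennreal (\<Sum>w\<in>F. rw w powr t) * (?P + ennreal \<epsilon>)"
      by (simp add: sum_distrib_right flip: sum_ennreal)
    finally have "?M * hausdorff_premeasure t \<delta> (L ` (K \<inter> U))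
        \<le> ?M * (ennreal (\<Sum>w\<in>F. rw w powr t) * (?P + ennreal \<epsilon>) + ennreal (B powr t) * ennreal \<epsilon>)"
      by (rule mult_left_mono) simp
    also have "\<dots> = (ennreal (\<Sum>w\<in>F. rw w powr t) * ?M) * (?P + ennreal \<epsilon>)
        + ennreal \<epsilon> * (?M * ennreal (B powr t))"
      by (simp add: distrib_left mult_ac)
    \<comment> \<open>The factor \<open>?M\<close> pays off here: times the sum of ratio powers it
      is at most \<open>?h\<close>, because the disjoint cylinders lie in \<open>K\<close> and in
      \<open>U\<close>.\<close>
    also have "\<dots> \<le> ?h * (?P + ennreal \<epsilon>) + ennreal \<epsilon> * (?M * ennreal (B powr t))"
      using F(2) Sw_subset_K F'(2)
      by (intro add_right_mono mult_right_mono measure_disjoint_cylinders[OF F(1)]) auto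
    also have "\<dots> = ?P * ?h + ennreal \<epsilon> * (?h + ?M * ennreal (B powr t))"
      by (simp add: distrib_left mult_ac add_ac)
    finally show "?M * hausdorff_premeasure t \<delta> (L ` (K \<inter> U))
        \<le> ?P * ?h + ennreal \<epsilon> * (?h + ?M * ennreal (B powr t))" .
  next
    show "?h + ?M * ennreal (B powr t) < \<infinity>"
      using measure_finite[of K] measure_finite[of "K \<inter> U"] by (simp add: ennreal_mult_less_top)
  qed
  show ?thesis
    unfolding hausdorff_measure_def[of t "L ` (K \<inter> U)"]
    by (subst SUP_mult_left_ennreal) (auto intro!: SUP_least step)
qed

end

section \<open>Rotation invariance, splitting along open sets, and the two comparison
  inequalities\<close>

context self_similar_measure
begin

lemma measure_K_cancel:
  "hausdorff_measure t K * a \<le> hausdorff_measure t K * b \<longleftrightarrow> a \<le> b"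
  using measure_K_pos measure_finite[of K] by (intro ennreal_mult_le_mult_iff) auto

lemma measure_linear_image_finite:
  fixes L :: "'a \<Rightarrow> 'b::euclidean_space"
  assumes "linear L" "A \<subseteq> K"
  shows "hausdorff_measure t (L ` A) < \<infinity>"
proof -
  obtain B where B: "0 < B" "\<And>x. norm (L x) \<le> B * norm x" using linear_bounded_pos[OF assms(1)] by auto
  have "dist (L x) (L y) \<le> B * dist x y" for x y
    using B(2)[of "x - y"] by (simp add: dist_norm linear_diff[OF assms(1)])
  then have "hausdorff_measure t (L ` A) \<le> ennreal (B powr t) * hausdorff_measure t A"
    using B(1) t_pos by (intro hausdorff_measure_lipschitz) auto
  also have "\<dots> < \<infinity>" using measure_finite[OF assms(2)] by (simp add: ennreal_mult_less_top)
  finally show ?thesis .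
qed

lemma measure_le_premeasure_rotation:
  fixes L :: "'a \<Rightarrow> 'b::euclidean_space"
  assumes "linear L" "Q \<in> rotations" "0 < D"
  shows "hausdorff_measure t (L ` K) \<le> hausdorff_premeasure t D (L ` blinfun_apply Q ` K)"
proof -
  have "hausdorff_measure t K * hausdorff_measure t (L ` (K \<inter> UNIV))
    \<le> hausdorff_premeasure t D (L ` blinfun_apply Q ` K) * hausdorff_measure t (K \<inter> UNIV)"
    using assms by (intro premeasure_linear_image_le) auto
  then have "hausdorff_measure t K * hausdorff_measure t (L ` K)
    \<le> hausdorff_measure t K * hausdorff_premeasure t D (L ` blinfun_apply Q ` K)"
    by (simp add: mult.commute)
  then show ?thesis by (simp only: measure_K_cancel)
qed

lemma measure_le_premeasure:
  fixes L :: "'a \<Rightarrow> 'b::euclidean_space"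
  assumes "linear L" "0 < D"
  shows "hausdorff_measure t (L ` K) \<le> hausdorff_premeasure t D (L ` K)"
  using measure_le_premeasure_rotation[OF assms(1) id_in_rotations assms(2)] by simp

text \<open>One inequality is the premeasure bound for \<open>Q\<close>. The other is the same bound
  for the map \<open>L\<close> after \<open>Q\<close> and the inverse of \<open>Q\<close>, which is
  again in \<open>rotations\<close>.\<close>

lemma measure_rotation_invariant:
  fixes L :: "'a \<Rightarrow> 'b::euclidean_space"
  assumes L: "linear L" and Q: "Q \<in> rotations"
  shows "hausdorff_measure t (L ` blinfun_apply Q ` K) = hausdorff_measure t (L ` K)"
proof (rule antisym)
  show "hausdorff_measure t (L ` K) \<le> hausdorff_measure t (L ` blinfun_apply Q ` K)"
    using measure_le_premeasure_rotation[OF L Q zero_less_one]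
    by (rule order_trans) (rule hausdorff_premeasure_le_measure[OF zero_less_one])
  obtain P where P: "orthogonal_transformation (blinfun_apply P)" "Q o\<^sub>L P = id_blinfun" "P o\<^sub>L Q = id_blinfun"
    using orthogonal_blinfun_inverse[OF orthogonal_rotations[OF Q]] by auto
  have P': "P \<in> rotations" by (rule rotations_inverse[OF Q P(3,1)])
  have "linear (blinfun_apply Q)" by (simp add: blinfun.bounded_linear_right bounded_linear.linear)
  then have LQ: "linear (L \<circ> blinfun_apply Q)" using L by (rule linear_compose)
  have "blinfun_apply Q (blinfun_apply P x) = x" for x
    using arg_cong[OF P(2), of "\<lambda>A. blinfun_apply A x"] by simp
  then have "(L \<circ> blinfun_apply Q) ` blinfun_apply P ` K = L ` K" by (simp add: image_image)
  then have "hausdorff_measure t (L ` blinfun_apply Q ` K) \<le> hausdorff_premeasure t 1 (L ` K)"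
    using measure_le_premeasure_rotation[OF LQ P' zero_less_one] by (simp add: image_comp)
  also have "\<dots> \<le> hausdorff_measure t (L ` K)" by (rule hausdorff_premeasure_le_measure[OF zero_less_one])
  finally show "hausdorff_measure t (L ` blinfun_apply Q ` K) \<le> hausdorff_measure t (L ` K)" .
qed

lemma measure_linear_image_open_le:
  fixes L :: "'a \<Rightarrow> 'b::euclidean_space"
  assumes "linear L" "open U"
  shows "hausdorff_measure t K * hausdorff_measure t (L ` (K \<inter> U))
    \<le> hausdorff_measure t (L ` K) * hausdorff_measure t (K \<inter> U)"
proof -
  have "hausdorff_premeasure t 1 (L ` K) \<le> hausdorff_measure t (L ` K)"
    by (rule hausdorff_premeasure_le_measure[OF zero_less_one])
  then show ?thesis
    using premeasure_linear_image_le[OF assms(1) id_in_rotations assms(2) zero_less_one]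
    by simp (meson mult_right_mono order_trans zero_le)
qed

text \<open>Caratheodory's condition for open sets, tested on \<open>K\<close>: finitely many
  cylinders inside \<open>U\<close> exhaust its part of \<open>K\<close> up to \<open>e\<close>, and
  being compact they have positive distance from the rest of \<open>K\<close>.\<close>

lemma measure_split_open:
  assumes "open U"
  shows "hausdorff_measure t (K \<inter> U) + hausdorff_measure t (K - U) = hausdorff_measure t K"
proof (rule antisym)
  have "K \<inter> U \<union> (K - U) = K" by auto
  then show "hausdorff_measure t K \<le> hausdorff_measure t (K \<inter> U) + hausdorff_measure t (K - U)"
    using hausdorff_measure_Un[of t "K \<inter> U" "K - U"] by simp
  show "hausdorff_measure t (K \<inter> U) + hausdorff_measure t (K - U) \<le> hausdorff_measure t K"
  proof (rule ennreal_le_epsilon)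
    fix e :: real assume e: "0 < e"
    obtain F where F: "disjoint_cylinders F" "\<And>w. w \<in> F \<Longrightarrow> Sw w ` K \<subseteq> U"
      "hausdorff_measure t (K \<inter> U - (\<Union>w\<in>F. Sw w ` K)) \<le> ennreal e"
      using cylinder_exhaustion[OF assms id_in_rotations zero_less_one zero_less_one e] by auto
    define C where "C = (\<Union>w\<in>F. Sw w ` K)"
    have F': "finite F" "\<And>w. w \<in> F \<Longrightarrow> w \<in> words" using F(1) by (auto simp: disjoint_cylinders_def)
    have C: "compact C" unfolding C_def using F' by (intro compact_UN compact_Sw_K)
    have C_sub: "C \<subseteq> K \<inter> U" unfolding C_def using F(2) Sw_subset_K F'(2) by blast
    have "compact (K - U)" using compact_K assms by (rule compact_diff)
    then have "\<exists>d>0. \<forall>x\<in>C. \<forall>y\<in>K - U. d \<le> dist x y"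
      using C C_sub by (intro separate_compact_closed compact_imp_closed) auto
    then obtain d where d: "0 < d" "\<And>x y. x \<in> C \<Longrightarrow> y \<in> K - U \<Longrightarrow> d \<le> dist x y" by auto
    have "hausdorff_measure t (K \<inter> U) \<le> hausdorff_measure t (C \<union> (K \<inter> U - C))"
      using C_sub by (intro hausdorff_measure_mono) auto
    also have "\<dots> \<le> hausdorff_measure t C + hausdorff_measure t (K \<inter> U - C)" by (rule hausdorff_measure_Un)
    also have "\<dots> \<le> hausdorff_measure t C + ennreal e" using F(3) by (simp add: C_def add_left_mono)
    finally have "hausdorff_measure t (K \<inter> U) + hausdorff_measure t (K - U)
        \<le> (hausdorff_measure t C + ennreal e) + hausdorff_measure t (K - U)" by (rule add_right_mono)
    also have "\<dots> = (hausdorff_measure t C + hausdorff_measure t (K - U)) + ennreal e"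
      by (simp add: add_ac)
    also have "hausdorff_measure t C + hausdorff_measure t (K - U) \<le> hausdorff_measure t (C \<union> (K - U))"
      using t_pos by (intro hausdorff_measure_separated[OF d(2,1)]) auto
    also have "hausdorff_measure t (C \<union> (K - U)) \<le> hausdorff_measure t K"
      using C_sub by (intro hausdorff_measure_mono) auto
    finally show "hausdorff_measure t (K \<inter> U) + hausdorff_measure t (K - U) \<le> hausdorff_measure t K + ennreal e"
      by (simp add: add_right_mono)
  qed
qed

text \<open>The measure of \<open>K\<close> is bounded by its premeasure at a scale so coarse that
  \<open>U\<close> itself is a covering set. Cover \<open>K\<close> by \<open>U\<close> and the
  remainder \<open>K - U\<close>, then subtract the finite measure of the remainder.\<close>

lemma measure_open_le_diam_power:
  assumes "open U" "bounded U"
  shows "hausdorff_measure t (K \<inter> U) \<le> diam_power t U"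
proof -
  \<comment> \<open>The added 1 keeps the scale positive when the diameter is 0.\<close>
  let ?D = "diameter U + 1"
  have D: "0 < ?D" using diameter_ge_0[OF assms(2)] by simp
  have "hausdorff_measure t (K \<inter> U) + hausdorff_measure t (K - U) = hausdorff_measure t (id ` K)"
    using measure_split_open[OF assms(1)] by simp
  also have "\<dots> \<le> hausdorff_premeasure t ?D (id ` K)"
    using D by (intro measure_le_premeasure linear_id)
  also have "\<dots> \<le> hausdorff_premeasure t ?D (U \<union> (K - U))" by (rule hausdorff_premeasure_mono) auto
  also have "\<dots> \<le> hausdorff_premeasure t ?D U + hausdorff_premeasure t ?D (K - U)"
    using D by (intro hausdorff_premeasure_Un) simp
  also have "\<dots> \<le> diam_power t U + hausdorff_measure t (K - U)"
    using D assms(2) by (intro add_mono hausdorff_premeasure_le_diam_power hausdorff_premeasure_le_measure) auto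
  finally have "hausdorff_measure t (K - U) + hausdorff_measure t (K \<inter> U)
      \<le> hausdorff_measure t (K - U) + diam_power t U" by (simp add: add.commute)
  then show ?thesis
    using measure_finite[of "K - U"] by (auto simp: ennreal_add_left_cancel_le)
qed

text \<open>\<open>A\<close> enters only through its open covers, so it may be arbitrary. The
  covering sets may overlap; the sum is therefore controlled by comparing each piece with its
  diameter power, not by adding measures of pieces of \<open>K\<close>.\<close>

lemma measure_linear_image_le:
  fixes L :: "'a \<Rightarrow> 'b::euclidean_space"
  assumes L: "linear L" and A: "A \<subseteq> K"
  shows "hausdorff_measure t K * hausdorff_measure t (L ` A)
    \<le> hausdorff_measure t (L ` K) * hausdorff_measure t A"
proof (rule ennreal_le_vanishing)
  let ?c = "hausdorff_measure t (L ` K)"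
  show "?c < \<infinity>" using L by (rule measure_linear_image_finite) simp
  fix e :: real assume e: "0 < e"
  have "hausdorff_premeasure t 1 A \<le> hausdorff_measure t A" by (rule hausdorff_premeasure_le_measure) simp
  also have "\<dots> < hausdorff_measure t A + ennreal e"
    using measure_finite[OF A] e ennreal_add_left_cancel_less[of "hausdorff_measure t A" 0 "ennreal e"]
    by (simp add: less_top)
  finally have "hausdorff_premeasure t 1 A < hausdorff_measure t A + ennreal e" .
  from hausdorff_premeasure_lessD_open[OF this, of 2] obtain U where
    U: "A \<subseteq> (\<Union>n. U n)" "\<And>n. open (U n)" "\<And>n. bounded (U n)"
      "(\<Sum>n. diam_power t (U n)) < hausdorff_measure t A + ennreal e"
    using t_pos by auto
  have "L ` A \<subseteq> (\<Union>n. L ` (K \<inter> U n))"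
  proof (rule image_subsetI)
    fix x assume "x \<in> A"
    then obtain n where "x \<in> U n" using U(1) by auto
    then show "L x \<in> (\<Union>n. L ` (K \<inter> U n))" using A \<open>x \<in> A\<close> by auto
  qed
  then have "hausdorff_measure t (L ` A) \<le> (\<Sum>n. hausdorff_measure t (L ` (K \<inter> U n)))"
    by (rule order_trans[OF hausdorff_measure_mono hausdorff_measure_countable_subadditive])
  then have "hausdorff_measure t K * hausdorff_measure t (L ` A)
      \<le> (\<Sum>n. hausdorff_measure t K * hausdorff_measure t (L ` (K \<inter> U n)))"
    by (simp add: mult_left_mono)
  also have "\<dots> \<le> (\<Sum>n. ?c * diam_power t (U n))"
  proof (intro suminf_le)
    fix n
    show "hausdorff_measure t K * hausdorff_measure t (L ` (K \<inter> U n)) \<le> ?c * diam_power t (U n)"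
      using measure_linear_image_open_le[OF L U(2)[of n]]
      by (rule order_trans) (intro mult_left_mono measure_open_le_diam_power U zero_le)
  qed auto
  also have "\<dots> = ?c * (\<Sum>n. diam_power t (U n))" by simp
  also have "\<dots> \<le> ?c * (hausdorff_measure t A + ennreal e)"
    using U(4) by (intro mult_left_mono) auto
  finally show "hausdorff_measure t K * hausdorff_measure t (L ` A) \<le> ?c * hausdorff_measure t A + ennreal e * ?c"
    by (simp add: distrib_left mult.commute)
qed

text \<open>The complement argument: at a scale admitting \<open>V\<close> as one covering set, the
  image of \<open>K\<close> costs at most \<open>V\<close> plus the image of what lies outside the
  preimage.\<close>

lemma measure_preimage_open_le_diam_power:
  fixes L :: "'a \<Rightarrow> 'b::euclidean_space"
  assumes L: "linear L" and V: "open V" "bounded V"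
  shows "hausdorff_measure t (L ` K) * hausdorff_measure t (K \<inter> L -` V)
    \<le> hausdorff_measure t K * diam_power t V"
proof -
  let ?c = "hausdorff_measure t (L ` K)" and ?M = "hausdorff_measure t K"
  let ?D = "diameter V + 1" and ?W = "L -` V"
  have D: "0 < ?D" using diameter_ge_0[OF V(2)] by simp
  have W: "open ?W"
    using V(1) L by (intro open_vimage linear_continuous_on) (auto simp: linear_conv_bounded_linear)
  have "?c \<le> hausdorff_premeasure t ?D (L ` K)" using L D by (rule measure_le_premeasure)
  also have "\<dots> \<le> hausdorff_premeasure t ?D (V \<union> L ` (K - ?W))" by (rule hausdorff_premeasure_mono) auto
  also have "\<dots> \<le> hausdorff_premeasure t ?D V + hausdorff_premeasure t ?D (L ` (K - ?W))"
    using D by (intro hausdorff_premeasure_Un) simp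
  also have "\<dots> \<le> diam_power t V + hausdorff_measure t (L ` (K - ?W))"
    using D V(2) by (intro add_mono hausdorff_premeasure_le_diam_power hausdorff_premeasure_le_measure) auto
  finally have "?M * ?c \<le> ?M * (diam_power t V + hausdorff_measure t (L ` (K - ?W)))"
    by (rule mult_left_mono) simp
  also have "\<dots> = ?M * diam_power t V + ?M * hausdorff_measure t (L ` (K - ?W))"
    by (simp add: distrib_left)
  \<comment> \<open>The upper bound for images turns the outside part into \<open>?c\<close> times a
    measure in \<open>K\<close>; after splitting \<open>K\<close> along the open set
    \<open>?W\<close>, this finite term cancels.\<close>
  also have "\<dots> \<le> ?M * diam_power t V + ?c * hausdorff_measure t (K - ?W)"
    using L by (intro add_left_mono measure_linear_image_le) auto
  finally have "?c * hausdorff_measure t (K - ?W) + ?c * hausdorff_measure t (K \<inter> ?W)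
      \<le> ?c * hausdorff_measure t (K - ?W) + ?M * diam_power t V"
    using measure_split_open[OF W]
    by (simp add: add.commute mult.commute[of ?M ?c] flip: distrib_left)
  moreover have "?c * hausdorff_measure t (K - ?W) < \<infinity>"
    using measure_finite[of "K - ?W"] measure_linear_image_finite[OF L, of K]
    by (simp add: ennreal_mult_less_top)
  ultimately show ?thesis by (auto simp: ennreal_add_left_cancel_le)
qed

text \<open>Mirror image of the upper bound: an open cover of the image of \<open>A\<close> is
  pulled back to \<open>A\<close>, and each preimage is charged to the diameter power of its
  covering set.\<close>

lemma measure_linear_image_ge:
  fixes L :: "'a \<Rightarrow> 'b::euclidean_space"
  assumes L: "linear L" and A: "A \<subseteq> K"
  shows "hausdorff_measure t (L ` K) * hausdorff_measure t A
    \<le> hausdorff_measure t K * hausdorff_measure t (L ` A)"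
proof (rule ennreal_le_vanishing)
  let ?c = "hausdorff_measure t (L ` K)" and ?M = "hausdorff_measure t K"
  show "?M < \<infinity>" by (rule measure_finite) simp
  fix e :: real assume e: "0 < e"
  have "hausdorff_premeasure t 1 (L ` A) \<le> hausdorff_measure t (L ` A)"
    by (rule hausdorff_premeasure_le_measure) simp
  also have "\<dots> < hausdorff_measure t (L ` A) + ennreal e"
    using measure_linear_image_finite[OF L A] e
      ennreal_add_left_cancel_less[of "hausdorff_measure t (L ` A)" 0 "ennreal e"]
    by (simp add: less_top)
  finally have "hausdorff_premeasure t 1 (L ` A) < hausdorff_measure t (L ` A) + ennreal e" .
  from hausdorff_premeasure_lessD_open[OF this, of 2] obtain V where
    V: "L ` A \<subseteq> (\<Union>n. V n)" "\<And>n. open (V n)" "\<And>n. bounded (V n)"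
      "(\<Sum>n. diam_power t (V n)) < hausdorff_measure t (L ` A) + ennreal e"
    using t_pos by auto
  have "A \<subseteq> (\<Union>n. K \<inter> L -` V n)"
  proof
    fix x assume x: "x \<in> A"
    then have "L x \<in> (\<Union>n. V n)" using V(1) by (rule subsetD[rotated, OF imageI])
    then show "x \<in> (\<Union>n. K \<inter> L -` V n)" using A x by auto
  qed
  then have "hausdorff_measure t A \<le> (\<Sum>n. hausdorff_measure t (K \<inter> L -` V n))"
    by (rule order_trans[OF hausdorff_measure_mono hausdorff_measure_countable_subadditive])
  then have "?c * hausdorff_measure t A \<le> (\<Sum>n. ?c * hausdorff_measure t (K \<inter> L -` V n))"
    by (simp add: mult_left_mono)
  also have "\<dots> \<le> (\<Sum>n. ?M * diam_power t (V n))"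
    using V by (intro suminf_le measure_preimage_open_le_diam_power[OF L]) auto
  also have "\<dots> = ?M * (\<Sum>n. diam_power t (V n))" by simp
  also have "\<dots> \<le> ?M * (hausdorff_measure t (L ` A) + ennreal e)"
    using V(4) by (intro mult_left_mono) auto
  finally show "?c * hausdorff_measure t A \<le> ?M * hausdorff_measure t (L ` A) + ennreal e * ?M"
    by (simp add: distrib_left mult.commute)
qed

text \<open>Both inequalities are applied to \<open>L\<close> after \<open>Q\<close>, and rotation
  invariance then removes \<open>Q\<close> from the constant. Dividing is legitimate since the
  measure of \<open>K\<close> is positive and finite.\<close>

lemma measure_linear_image:
  fixes L :: "'a \<Rightarrow> 'b::euclidean_space"
  assumes L: "linear L" and Q: "Q \<in> rotations" and A: "A \<subseteq> K"
  shows "hausdorff_measure t ((L \<circ> blinfun_apply Q) ` A) =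
    hausdorff_measure t A / hausdorff_measure t K * hausdorff_measure t (L ` K)"
proof -
  let ?M = "hausdorff_measure t K"
  have "linear (blinfun_apply Q)" by (simp add: blinfun.bounded_linear_right bounded_linear.linear)
  then have LQ: "linear (L \<circ> blinfun_apply Q)" using L by (rule linear_compose)
  have "?M * hausdorff_measure t ((L \<circ> blinfun_apply Q) ` A)
      = hausdorff_measure t ((L \<circ> blinfun_apply Q) ` K) * hausdorff_measure t A"
    by (rule antisym[OF measure_linear_image_le[OF LQ A] measure_linear_image_ge[OF LQ A]])
  also have "hausdorff_measure t ((L \<circ> blinfun_apply Q) ` K) = hausdorff_measure t (L ` K)"
    using measure_rotation_invariant[OF L Q] by (simp add: image_comp)
  finally have eq: "hausdorff_measure t ((L \<circ> blinfun_apply Q) ` A) * ?M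
      = hausdorff_measure t A * hausdorff_measure t (L ` K)"
    by (simp add: mult.commute)
  have "hausdorff_measure t ((L \<circ> blinfun_apply Q) ` A)
      = hausdorff_measure t ((L \<circ> blinfun_apply Q) ` A) * ?M / ?M"
    using measure_K_pos measure_finite[of K] by (intro mult_divide_eq_ennreal[symmetric]) auto
  also have "\<dots> = hausdorff_measure t A / ?M * hausdorff_measure t (L ` K)"
    unfolding eq by (simp only: ennreal_times_divide mult.commute[of _ "hausdorff_measure t (L ` K)"])
  finally show ?thesis .
qed

end

theorem theorem1p3:
  fixes S :: "nat \<Rightarrow> real^'d \<Rightarrow> real^'d"
    and r :: "nat \<Rightarrow> real"
    and T :: "nat \<Rightarrow> (real^'d) \<Rightarrow>\<^sub>L (real^'d)"
    and v :: "nat \<Rightarrow> real^'d"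
    and m :: nat
    and K :: "(real^'d) set"
    and t :: real
    and L :: "real^'d \<Rightarrow> real^'e"
  assumes "ss_ifs m S r T v"
    and "is_attractor m S K"
    and "\<exists>x \<in> K. \<exists>y \<in> K. x \<noteq> y"
    and "ereal t = hausdorff_dim K"
    and "linear L"
    and "hausdorff_measure t K > 0"
  shows "\<forall>A Q. A \<subseteq> K \<longrightarrow> Q \<in> closed_transformation_group m T \<longrightarrow>
           hausdorff_measure t ((L \<circ> blinfun_apply Q) ` A) =
             hausdorff_measure t A / hausdorff_measure t K * hausdorff_measure t (L ` K)"
proof (intro allI impI)
  fix A :: "(real^'d) set" and Q :: "(real^'d) \<Rightarrow>\<^sub>L (real^'d)"
  assume A: "A \<subseteq> K" and Q: "Q \<in> closed_transformation_group m T"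
  interpret self_similar_measure m S r T v K t
    using assms by unfold_locales auto
  show "hausdorff_measure t ((L \<circ> blinfun_apply Q) ` A) =
      hausdorff_measure t A / hausdorff_measure t K * hausdorff_measure t (L ` K)"
    using closed_transformation_group_subset Q A by (intro measure_linear_image assms(5)) auto
qed

end
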